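(* For all integers $n\ge 4$, \[ p(n,3)=b(n,3)=4E(n-1,3)-\left(\binom{n}{3}-\binom{n}{2}+4\right)2^{n-2}-22\binom{n}{5}+16\binom{n}{4}-4\binom{n}{3}+2n. \]
   Context: For a permutation $\pi=\pi_1\cdots\pi_n\in S_n$, a position $i\in\{1,\dots,n-1\}$ is an ascent if $\pi_i<\pi_{i+1}$ and a descent if $\pi_i>\pi_{i+1}$. The permutation $\pi$ is called ballot if for every $1\le k\le n-1$, the number of ascents among positions $1,\dots,k$ is at least the number of descents among positions $1,\dots,k$. Let $b(n,d)$ be the number of ballot permutations in $S_n$ with exactly $d$ descents. For a cycle $\mathfrak c=(c_1,\dots,c_k)$ of a permutation (fixed points are cycles of length 1), let $\mathrm{cA}(\mathfrak c)$ be the number of $i\in\{1,\dots,k\}$ with $c_i\le c_{i+1}$ and $\mathrm{cD}(\mathfrak c)$ the number with $c_i>c_{i+1}$, where $c_{k+1}=c_1$; let $M(\mathfrak c)=\min(\mathrm{cA}(\mathfrak c),\mathrm{cD}(\mathfrak c))$, and for a permutation $\pi$ let $M(\pi)$ be the sum of $M$ over its cycles. Let $p(n,d)$ be the number of permutations in $S_n$ all of whose cycles have odd length and with $M(\pi)=d$. $E(n,d)$ denotes the Eulerian number: the number of permutations of $[n]$ with exactly $d$ descents, with $E(0,0)=1$ and $E(0,d)=0$ for $d\ge1$. *)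

theory Defs
  imports Complex_Main "HOL-Combinatorics.Combinatorics"
begin

text \<open>
  The symmetric group on \<open>[n]\<close> is the set of functions \<open>\<pi>\<close> with \<open>\<pi> permutes {1..n}\<close>;
  the one-line notation of such a \<open>\<pi>\<close> is \<open>\<pi> 1, \<dots>, \<pi> n\<close>.
\<close>

definition ascents :: "nat \<Rightarrow> (nat \<Rightarrow> nat) \<Rightarrow> nat set" where
  "ascents n \<pi> = {i \<in> {1..<n}. \<pi> i < \<pi> (i + 1)}"

definition descents :: "nat \<Rightarrow> (nat \<Rightarrow> nat) \<Rightarrow> nat set" where
  "descents n \<pi> = {i \<in> {1..<n}. \<pi> i > \<pi> (i + 1)}"

definition ballot :: "nat \<Rightarrow> (nat \<Rightarrow> nat) \<Rightarrow> bool" where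
  "ballot n \<pi> \<longleftrightarrow>
     (\<forall>k\<in>{1..<n}. card (descents n \<pi> \<inter> {1..k}) \<le> card (ascents n \<pi> \<inter> {1..k}))"

definition ballot_number :: "nat \<Rightarrow> nat \<Rightarrow> nat" where
  "ballot_number n d =
     card {\<pi>. \<pi> permutes {1..n} \<and> ballot n \<pi> \<and> card (descents n \<pi>) = d}"

definition eulerian_number :: "nat \<Rightarrow> nat \<Rightarrow> nat" where
  "eulerian_number n d = card {\<pi>. \<pi> permutes {1..n} \<and> card (descents n \<pi>) = d}"

text \<open>
  The cycle \<open>(c\<^sub>1, \<dots>, c\<^sub>k)\<close> of \<open>\<pi>\<close> is represented by its underlying set \<open>C\<close>, an orbit of \<open>\<pi>\<close>.
  Its entries are distinct and the cyclic successor of an entry \<open>c\<close> is \<open>\<pi> c\<close>, so counting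
  indices of the cycle amounts to counting elements of \<open>C\<close>.
\<close>

definition cycles_of :: "nat \<Rightarrow> (nat \<Rightarrow> nat) \<Rightarrow> nat set set" where
  "cycles_of n \<pi> = orbit \<pi> ` {1..n}"

definition cyc_asc :: "(nat \<Rightarrow> nat) \<Rightarrow> nat set \<Rightarrow> nat" where
  "cyc_asc \<pi> C = card {c \<in> C. c \<le> \<pi> c}"

definition cyc_des :: "(nat \<Rightarrow> nat) \<Rightarrow> nat set \<Rightarrow> nat" where
  "cyc_des \<pi> C = card {c \<in> C. c > \<pi> c}"

definition cycle_M :: "(nat \<Rightarrow> nat) \<Rightarrow> nat set \<Rightarrow> nat" where
  "cycle_M \<pi> C = min (cyc_asc \<pi> C) (cyc_des \<pi> C)"

definition perm_M :: "nat \<Rightarrow> (nat \<Rightarrow> nat) \<Rightarrow> nat" where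
  "perm_M n \<pi> = (\<Sum>C\<in>cycles_of n \<pi>. cycle_M \<pi> C)"

definition odd_cycle_number :: "nat \<Rightarrow> nat \<Rightarrow> nat" where
  "odd_cycle_number n d =
     card {\<pi>. \<pi> permutes {1..n} \<and> (\<forall>C\<in>cycles_of n \<pi>. odd (card C)) \<and> perm_M n \<pi> = d}"

end

theory Submission
  imports Defs "HOL-Library.Infinite_Set" "HOL-Computational_Algebra.Formal_Power_Series"
begin

text \<open>
  Both numbers are computed explicitly.

  For ballot permutations, encode a permutation by its word of ascents \<open>A\<close> and descents \<open>D\<close>.
  A word with three descents fails to be ballot exactly if it starts with \<open>D\<close>, \<open>ADD\<close>, \<open>AADDD\<close>
  or \<open>ADADD\<close>. Choosing which values occupy the first \<open>|w| + 1\<close> positions shows that the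
  permutations whose word starts with \<open>wA\<close> or \<open>wD\<close> are counted by a binomial coefficient times
  the number of permutations with word \<open>w\<close> times an Eulerian number; this evaluates all prefix
  counts recursively.

  For odd-cycle permutations, remove the cycle through the largest element. Written from that
  element on, it is an arbitrary arrangement of an even number \<open>j\<close> of other elements, and since
  Eulerian numbers are symmetric, \<open>2 E(j, k - 1)\<close> arrangements give \<open>M = k\<close> if \<open>1 \<le> k \<le> j / 2\<close>.
  The resulting recurrence is a triangular system of linear differential equations for the
  exponential generating functions, with exponential polynomials as solutions.
\<close>

unbundle fps_syntax

section \<open>Descent words\<close>

text \<open>\<open>True\<close> marks a descent. \<open>False\<close> means only "no descent"; it
  marks an ascent once the entries are distinct.\<close>

fun updown :: "nat list \<Rightarrow> bool list" where
  "updown (x # y # zs) = (y < x) # updown (y # zs)"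
| "updown _ = []"

lemma length_updown [simp]: "length (updown xs) = length xs - 1"
  by (induction xs rule: updown.induct) auto

lemma nth_updown: "Suc i < length xs \<Longrightarrow> updown xs ! i \<longleftrightarrow> xs ! Suc i < xs ! i"
  by (induction xs arbitrary: i rule: updown.induct) (auto simp: nth_Cons split: nat.split)

lemma updown_append:
  "xs \<noteq> [] \<Longrightarrow> ys \<noteq> [] \<Longrightarrow> updown (xs @ ys) = updown xs @ (hd ys < last xs) # updown ys"
proof (induction xs rule: updown.induct)
  case ("2_2" v)
  then show ?case by (cases ys) auto
qed auto

lemma updown_map_strict_mono:
  assumes "strict_mono_on A f" "set xs \<subseteq> A"
  shows "updown (map f xs) = updown xs"
  using assms(2)
  by (induction xs rule: updown.induct) (auto simp: strict_mono_on_less[OF assms(1)])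

abbreviation ndes :: "bool list \<Rightarrow> nat" where
  "ndes w \<equiv> count_list w True"

text \<open>The values are \<open>{..<n}\<close> because only their relative order matters;
  \<open>card_updown\<close> transfers the count to any finite set of values.\<close>

definition word_count :: "nat \<Rightarrow> (bool list \<Rightarrow> bool) \<Rightarrow> nat" where
  "word_count n P = card {xs \<in> permutations_of_set {..<n}. P (updown xs)}"

text \<open>The increasing enumeration of \<open>S\<close> preserves all comparisons and hence the
  word.\<close>

lemma card_updown:
  assumes "finite S"
  shows "card {xs \<in> permutations_of_set S. P (updown xs)} = word_count (card S) P"
proof -
  obtain h where h: "bij_betw h {..<card S} S" "strict_mono_on {..<card S} h"
    using ex_bij_betw_strict_mono_card[OF assms] by blast
  have inj: "inj_on h {..<card S}" using h by (simp add: bij_betw_def)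
  have S: "S = h ` {..<card S}" using h by (simp add: bij_betw_def)
  have perms: "permutations_of_set S = map h ` permutations_of_set {..<card S}"
    by (subst S) (rule permutations_of_set_image_inj[OF inj])
  have "{xs \<in> permutations_of_set S. P (updown xs)} =
      map h ` {xs \<in> permutations_of_set {..<card S}. P (updown xs)}"
    unfolding perms using updown_map_strict_mono[OF h(2)]
    by (auto simp: permutations_of_set_def)
  moreover have "inj_on (map h) {xs \<in> permutations_of_set {..<card S}. P (updown xs)}"
  proof (rule inj_onI)
    fix xs ys assume "xs \<in> {xs \<in> permutations_of_set {..<card S}. P (updown xs)}"
      "ys \<in> {xs \<in> permutations_of_set {..<card S}. P (updown xs)}"
      and eq: "map h xs = map h ys"
    then have "set xs \<union> set ys = {..<card S}"
      by (simp add: permutations_of_set_def)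
    then show "xs = ys" using inj eq by (simp add: inj_on_map_eq_map)
  qed
  ultimately show ?thesis
    by (simp add: card_image word_count_def)
qed

lemma word_count_cong:
  assumes "\<And>w. length w = n - 1 \<Longrightarrow> P w \<longleftrightarrow> Q w"
  shows "word_count n P = word_count n Q"
proof -
  have "length (updown xs) = n - 1" if "xs \<in> permutations_of_set {..<n}" for xs
    using that length_finite_permutations_of_set by fastforce
  then show ?thesis unfolding word_count_def
    using assms by (intro arg_cong[where f = card] Collect_cong) blast
qed

lemma word_count_split:
  "word_count n P = word_count n (\<lambda>w. P w \<and> Q w) + word_count n (\<lambda>w. P w \<and> \<not> Q w)"
  unfolding word_count_def
  by (subst card_Un_disjoint[symmetric]) (simp, simp, blast, rule arg_cong[where f = card], blast)

lemma word_count_disj: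
  assumes "\<And>w. P w \<Longrightarrow> Q w \<Longrightarrow> False"
  shows "word_count n (\<lambda>w. P w \<or> Q w) = word_count n P + word_count n Q"
proof -
  have "word_count n (\<lambda>w. P w \<or> Q w) =
      word_count n (\<lambda>w. (P w \<or> Q w) \<and> P w) + word_count n (\<lambda>w. (P w \<or> Q w) \<and> \<not> P w)"
    by (rule word_count_split)
  moreover have "word_count n (\<lambda>w. (P w \<or> Q w) \<and> P w) = word_count n P"
    "word_count n (\<lambda>w. (P w \<or> Q w) \<and> \<not> P w) = word_count n Q"
    using assms by (auto intro!: word_count_cong)
  ultimately show ?thesis by simp
qed

text \<open>Choose the set \<open>A\<close> of values in the first \<open>k\<close> positions; the
  two blocks are then independent arrangements of \<open>A\<close> and of its complement. The
  comparison across the cut is left free.\<close>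

lemma word_count_take_drop:
  assumes "k \<le> n"
  shows "card {xs \<in> permutations_of_set {..<n}. P (updown (take k xs)) \<and> Q (updown (drop k xs))}
    = (n choose k) * word_count k P * word_count (n - k) Q"
proof -
  define K where "K = {A. A \<subseteq> {..<n} \<and> card A = k}"
  define T where "T A = {xs \<in> permutations_of_set A. P (updown xs)} \<times>
    {xs \<in> permutations_of_set ({..<n} - A). Q (updown xs)}" for A
  have finK: "finite K" unfolding K_def by simp
  have "bij_betw (\<lambda>(A, xs, ys). xs @ ys) (Sigma K T)
    {xs \<in> permutations_of_set {..<n}. P (updown (take k xs)) \<and> Q (updown (drop k xs))}"
  proof (rule bij_betw_byWitness[where f' = "\<lambda>xs. (set (take k xs), take k xs, drop k xs)"])
    have len: "length xs = k" if "A \<in> K" "xs \<in> permutations_of_set A" for A xs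
      using that distinct_card[of xs] by (auto simp: K_def permutations_of_set_def)
    show "\<forall>a\<in>Sigma K T. (set (take k (case a of (A, xs, ys) \<Rightarrow> xs @ ys)),
        take k (case a of (A, xs, ys) \<Rightarrow> xs @ ys), drop k (case a of (A, xs, ys) \<Rightarrow> xs @ ys)) = a"
      by (auto simp: T_def len permutations_of_set_def)
    show "(\<lambda>(A, xs, ys). xs @ ys) ` Sigma K T \<subseteq>
       {xs \<in> permutations_of_set {..<n}. P (updown (take k xs)) \<and> Q (updown (drop k xs))}"
      by (auto simp: T_def len K_def permutations_of_set_def)
    show "(\<lambda>xs. (set (take k xs), take k xs, drop k xs)) `
      {xs \<in> permutations_of_set {..<n}. P (updown (take k xs)) \<and> Q (updown (drop k xs))} \<subseteq> Sigma K T"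
    proof (rule image_subsetI)
      fix xs assume "xs \<in> {xs \<in> permutations_of_set {..<n}. P (updown (take k xs)) \<and> Q (updown (drop k xs))}"
      then have xs: "xs \<in> permutations_of_set {..<n}"
        and PQ: "P (updown (take k xs))" "Q (updown (drop k xs))" by auto
      have s: "set xs = {..<n}" "distinct xs" using xs by (auto simp: permutations_of_set_def)
      have l: "length xs = n" using s distinct_card by fastforce
      have dis: "set (take k xs) \<inter> set (drop k xs) = {}"
        using s(2) by (metis append_take_drop_id distinct_append)
      have un: "set (take k xs) \<union> set (drop k xs) = {..<n}"
        using s(1) by (metis append_take_drop_id set_append)
      have "set (take k xs) \<in> K"
        unfolding K_def using un s l assms by (auto simp: distinct_card)
      moreover have "set (drop k xs) = {..<n} - set (take k xs)" using dis un by blast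
      ultimately show "(set (take k xs), take k xs, drop k xs) \<in> Sigma K T"
        using s PQ by (auto simp: T_def permutations_of_set_def)
    qed
  qed auto
  then have "card {xs \<in> permutations_of_set {..<n}. P (updown (take k xs)) \<and> Q (updown (drop k xs))}
    = card (Sigma K T)"
    by (simp add: bij_betw_same_card)
  also have "\<dots> = (\<Sum>A\<in>K. card (T A))"
    by (rule card_SigmaI[OF finK]) (simp add: T_def)
  also have "\<dots> = (\<Sum>A\<in>K. word_count k P * word_count (n - k) Q)"
  proof (rule sum.cong[OF refl])
    fix A assume A: "A \<in> K"
    then have f: "finite A" "A \<subseteq> {..<n}" "card A = k" by (auto simp: K_def finite_subset)
    have "card ({..<n} - A) = n - k" using f by (simp add: card_Diff_subset)
    then show "card (T A) = word_count k P * word_count (n - k) Q"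
      unfolding T_def using card_updown[OF f(1)] card_updown[of "{..<n} - A"] f
      by (simp add: card_cartesian_product)
  qed
  also have "\<dots> = (n choose k) * word_count k P * word_count (n - k) Q"
    using n_subsets[of "{..<n}" k] by (simp add: K_def)
  finally show ?thesis .
qed

lemma word_count_False [simp]: "word_count n (\<lambda>_. False) = 0"
  by (simp add: word_count_def)

lemma word_count_0: "word_count 0 P = (if P [] then 1 else 0)"
proof -
  have "{xs \<in> permutations_of_set {..<0::nat}. P (updown xs)} = (if P [] then {[]} else {})" by auto
  then show ?thesis by (simp add: word_count_def)
qed

section \<open>Eulerian numbers\<close>

definition one_line :: "nat \<Rightarrow> (nat \<Rightarrow> nat) \<Rightarrow> nat list" where
  "one_line n \<pi> = map \<pi> [1..<Suc n]"

text \<open>The list determines the permutation because points outside \<open>{1..n}\<close> are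
  fixed. Surjectivity follows by counting, since both sets have \<open>fact n\<close>
  elements.\<close>

lemma bij_betw_one_line:
  "bij_betw (one_line n) {\<pi>. \<pi> permutes {1..n}} (permutations_of_set {1..n})"
proof -
  have inj: "inj_on (one_line n) {\<pi>. \<pi> permutes {1..n}}"
  proof (rule inj_onI, rule ext)
    fix \<pi> \<sigma> x
    assume *: "\<pi> \<in> {\<pi>. \<pi> permutes {1..n}}" "\<sigma> \<in> {\<pi>. \<pi> permutes {1..n}}" "one_line n \<pi> = one_line n \<sigma>"
    then have eq: "\<forall>x\<in>{1..n}. \<pi> x = \<sigma> x"
      unfolding one_line_def by (auto simp del: upt_Suc)
    show "\<pi> x = \<sigma> x"
    proof (cases "x \<in> {1..n}")
      case False
      then show ?thesis using *(1,2) by (simp add: permutes_not_in)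
    qed (use eq in blast)
  qed
  have sub: "one_line n ` {\<pi>. \<pi> permutes {1..n}} \<subseteq> permutations_of_set {1..n}"
  proof clarify
    fix \<pi> assume p: "\<pi> permutes {1..n}"
    have "set (one_line n \<pi>) = \<pi> ` {1..n}"
      unfolding one_line_def by (auto simp del: upt_Suc)
    then show "one_line n \<pi> \<in> permutations_of_set {1..n}"
      using permutes_image[OF p] permutes_inj_on[OF p]
      by (auto simp: permutations_of_set_def one_line_def distinct_map simp del: upt_Suc)
  qed
  have "one_line n ` {\<pi>. \<pi> permutes {1..n}} = permutations_of_set {1..n}"
  proof (rule card_subset_eq[OF finite_permutations_of_set sub])
    have "card {\<pi>. \<pi> permutes {1..n}} = fact n" by (rule card_permutations) auto
    then show "card (one_line n ` {\<pi>. \<pi> permutes {1..n}}) = card (permutations_of_set {1..n})"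
      unfolding card_image[OF inj] by simp
  qed
  then show ?thesis using inj by (simp add: bij_betw_def)
qed

lemma card_permutes_updown:
  "card {\<pi>. \<pi> permutes {1..n} \<and> P (updown (one_line n \<pi>))} = word_count n P"
proof -
  have "bij_betw (one_line n) {\<pi> \<in> {\<pi>. \<pi> permutes {1..n}}. P (updown (one_line n \<pi>))}
      {xs \<in> permutations_of_set {1..n}. P (updown xs)}"
    using bij_betw_one_line[of n] by (fastforce simp: bij_betw_def inj_on_def)
  from bij_betw_same_card[OF this] show ?thesis
    using card_updown[of "{1..n}" P] by simp
qed

lemma count_list_conv_card: "count_list w b = card {i. i < length w \<and> w ! i = b}"
proof -
  have "count_list w b = length (filter (\<lambda>x. x = b) w)" by (induction w) auto
  then show ?thesis by (simp add: length_filter_conv_card)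
qed

lemma nth_updown_one_line:
  assumes "Suc i < n"
  shows "updown (one_line n \<pi>) ! i \<longleftrightarrow> \<pi> (Suc i + 1) < \<pi> (Suc i)"
  using assms nth_updown[of i "one_line n \<pi>"] by (simp add: one_line_def del: upt_Suc)

lemma card_descents_upto:
  "card (descents n \<pi> \<inter> {1..k}) = count_list (take k (updown (one_line n \<pi>))) True"
proof -
  have len: "length (updown (one_line n \<pi>)) = n - 1" by (simp add: one_line_def)
  \<comment> \<open>Positions of a permutation start at 1 and list indices at 0, hence the shift by
    \<open>Suc\<close>.\<close>
  have "descents n \<pi> \<inter> {1..k} = Suc ` {i. i < k \<and> i < n - 1 \<and> updown (one_line n \<pi>) ! i}"
  proof (intro equalityI subsetI)
    fix i assume "i \<in> descents n \<pi> \<inter> {1..k}"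
    then show "i \<in> Suc ` {i. i < k \<and> i < n - 1 \<and> updown (one_line n \<pi>) ! i}"
      using nth_updown_one_line[of "i - 1" n \<pi>]
      by (intro image_eqI[of _ _ "i - 1"]) (auto simp: descents_def)
  next
    fix i assume "i \<in> Suc ` {i. i < k \<and> i < n - 1 \<and> updown (one_line n \<pi>) ! i}"
    then show "i \<in> descents n \<pi> \<inter> {1..k}"
      using nth_updown_one_line[of "i - 1" n \<pi>] by (auto simp: descents_def)
  qed
  moreover have "{i. i < k \<and> i < n - 1 \<and> updown (one_line n \<pi>) ! i} =
     {i. i < length (take k (updown (one_line n \<pi>))) \<and> take k (updown (one_line n \<pi>)) ! i = True}"
    using len by auto
  ultimately show ?thesis by (simp add: count_list_conv_card card_image)
qed

text \<open>Here injectivity of the permutation is what turns "no descent" into an ascent.\<close>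

lemma card_ascents_upto:
  assumes "\<pi> permutes {1..n}"
  shows "card (ascents n \<pi> \<inter> {1..k}) = count_list (take k (updown (one_line n \<pi>))) False"
proof -
  have len: "length (updown (one_line n \<pi>)) = n - 1" by (simp add: one_line_def)
  have ne: "\<pi> (Suc i) \<noteq> \<pi> i" for i
    using permutes_inj[OF assms] by (metis injD n_not_Suc_n)
  have "ascents n \<pi> \<inter> {1..k} = Suc ` {i. i < k \<and> i < n - 1 \<and> \<not> updown (one_line n \<pi>) ! i}"
  proof (intro equalityI subsetI)
    fix i assume "i \<in> ascents n \<pi> \<inter> {1..k}"
    then show "i \<in> Suc ` {i. i < k \<and> i < n - 1 \<and> \<not> updown (one_line n \<pi>) ! i}"
      using nth_updown_one_line[of "i - 1" n \<pi>]
      by (intro image_eqI[of _ _ "i - 1"]) (auto simp: ascents_def)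
  next
    fix i assume "i \<in> Suc ` {i. i < k \<and> i < n - 1 \<and> \<not> updown (one_line n \<pi>) ! i}"
    then show "i \<in> ascents n \<pi> \<inter> {1..k}"
      using nth_updown_one_line[of "i - 1" n \<pi>] ne[of i] by (auto simp: ascents_def less_diff_conv nat_neq_iff)
  qed
  moreover have "{i. i < k \<and> i < n - 1 \<and> \<not> updown (one_line n \<pi>) ! i} =
     {i. i < length (take k (updown (one_line n \<pi>))) \<and> take k (updown (one_line n \<pi>)) ! i = False}"
    using len by auto
  ultimately show ?thesis by (simp add: count_list_conv_card card_image)
qed

lemma card_descents: "card (descents n \<pi>) = ndes (updown (one_line n \<pi>))"
proof -
  have "descents n \<pi> \<inter> {1..n} = descents n \<pi>" by (auto simp: descents_def)
  moreover have "take n (updown (one_line n \<pi>)) = updown (one_line n \<pi>)"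
    by (simp add: one_line_def)
  ultimately show ?thesis using card_descents_upto[of n \<pi> n] by simp
qed

lemma eulerian_number_word_count: "eulerian_number n d = word_count n (\<lambda>w. ndes w = d)"
  unfolding eulerian_number_def card_descents
  using card_permutes_updown[of n "\<lambda>w. ndes w = d"] by simp

lemma updown_rev: "distinct xs \<Longrightarrow> updown (rev xs) = rev (map Not (updown xs))"
proof (induction xs rule: updown.induct)
  case (1 x y zs)
  then show ?case using updown_append[of "rev (y # zs)" "[x]"] by (auto simp: neq_iff)
qed auto

lemma ndes_map_Not: "ndes (map Not w) = length w - ndes w"
proof (induction w)
  case (Cons a w)
  then show ?case using count_le_length[of w True] by auto
qed auto

text \<open>Reversing the list exchanges ascents and descents.\<close>

lemma eulerian_number_symmetric:
  assumes "d < n" shows "eulerian_number n (n - 1 - d) = eulerian_number n d"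
proof -
  have "bij_betw rev {xs \<in> permutations_of_set {..<n}. ndes (updown xs) = n - 1 - d}
      {xs \<in> permutations_of_set {..<n}. ndes (updown xs) = d}"
  proof (rule bij_betw_byWitness[where f' = rev])
    have *: "ndes (updown (rev xs)) = n - 1 - ndes (updown xs) \<and> rev xs \<in> permutations_of_set {..<n}
       \<and> ndes (updown xs) \<le> n - 1"
      if "xs \<in> permutations_of_set {..<n}" for xs
    proof -
      have "length xs = n" using that length_finite_permutations_of_set by fastforce
      then show ?thesis using that count_le_length[of "updown xs" True]
        by (simp add: updown_rev ndes_map_Not permutations_of_set_def)
    qed
    show "rev ` {xs \<in> permutations_of_set {..<n}. ndes (updown xs) = n - 1 - d}
       \<subseteq> {xs \<in> permutations_of_set {..<n}. ndes (updown xs) = d}"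
      using * assms by auto
    show "rev ` {xs \<in> permutations_of_set {..<n}. ndes (updown xs) = d}
       \<subseteq> {xs \<in> permutations_of_set {..<n}. ndes (updown xs) = n - 1 - d}"
      using * assms by auto
  qed auto
  then show ?thesis
    unfolding eulerian_number_word_count word_count_def by (rule bij_betw_same_card)
qed

section \<open>Insertion of a new maximum and the Eulerian recurrence\<close>

definition insert_at :: "nat \<Rightarrow> nat \<Rightarrow> nat list \<Rightarrow> nat list" where
  "insert_at m i xs = take i xs @ m # drop i xs"

text \<open>A maximum at the end adds an ascent. Inside a descent it replaces \<open>True\<close> by
  \<open>False, True\<close>, which leaves the number of descents unchanged. At the front or inside
  an ascent it creates one new descent.\<close>

lemma ndes_insert_at:
  assumes "\<forall>x\<in>set xs. x < m" "i \<le> length xs"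
  shows "ndes (updown (insert_at m i xs)) = ndes (updown xs) +
    (if i = length xs \<or> (0 < i \<and> updown xs ! (i - 1)) then 0 else 1)"
proof -
  consider "i = length xs" | "i = 0" "xs \<noteq> []" | "0 < i" "i < length xs" using assms(2) by fastforce
  then show ?thesis
  proof cases
    case 1
    show ?thesis
    proof (cases "xs = []")
      case False
      then have "last xs < m" using assms(1) by simp
      then show ?thesis using 1 False by (simp add: insert_at_def updown_append)
    qed (use 1 in \<open>simp add: insert_at_def\<close>)
  next
    case 2
    then show ?thesis using assms(1) by (cases xs) (auto simp: insert_at_def)
  next
    case 3
    have ne: "take i xs \<noteq> []" "drop i xs \<noteq> []" using 3 by auto
    have "last (take i xs) \<in> set xs" using ne(1) last_in_set in_set_takeD by metis
    then have a: "\<not> m < last (take i xs)" using assms(1) by fastforce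
    have "hd (drop i xs) \<in> set xs" using ne(2) hd_in_set in_set_dropD by metis
    then have b: "hd (drop i xs) < m" using assms(1) by simp
    have c: "updown (m # drop i xs) = True # updown (drop i xs)"
      using b ne(2) by (cases "drop i xs") auto
    have i: "updown (insert_at m i xs) = updown (take i xs) @ False # True # updown (drop i xs)"
      unfolding insert_at_def using a c ne by (simp add: updown_append)
    have x: "updown xs = updown (take i xs) @ (hd (drop i xs) < last (take i xs)) # updown (drop i xs)"
      using updown_append[OF ne] by simp
    have "updown xs ! (i - 1) = (hd (drop i xs) < last (take i xs))"
      by (subst x) (use 3 in \<open>simp add: nth_append\<close>)
    then show ?thesis using 3 i arg_cong[OF x, of ndes] by simp
  qed
qed

lemma card_insert_at_same:
  assumes "\<forall>x\<in>set xs. x < m"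
  shows "card {i \<in> {..length xs}. ndes (updown (insert_at m i xs)) = ndes (updown xs)} =
    Suc (ndes (updown xs))"
proof -
  have "{i \<in> {..length xs}. ndes (updown (insert_at m i xs)) = ndes (updown xs)} =
    insert (length xs) (Suc ` {i. i < length (updown xs) \<and> updown xs ! i = True})"
    (is "?L = insert _ (Suc ` ?R)")
  proof (intro equalityI subsetI)
    fix i assume "i \<in> ?L"
    then have "i = length xs \<or> (0 < i \<and> i < length xs \<and> updown xs ! (i - 1))"
      using ndes_insert_at[OF assms, of i] by (auto split: if_splits)
    then show "i \<in> insert (length xs) (Suc ` ?R)"
      by (auto intro!: image_eqI[of _ _ "i - 1"])
  next
    fix i assume "i \<in> insert (length xs) (Suc ` ?R)"
    then show "i \<in> ?L" using ndes_insert_at[OF assms, of i] by auto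
  qed
  moreover have "length xs \<notin> Suc ` ?R" by auto
  ultimately show ?thesis
    by (simp add: card_image count_list_conv_card)
qed

lemma card_insert_at:
  assumes "\<forall>x\<in>set xs. x < m"
  shows "card {i \<in> {..length xs}. ndes (updown (insert_at m i xs)) = d} =
    (if ndes (updown xs) = d then Suc d else if Suc (ndes (updown xs)) = d then Suc (length xs) - d else 0)"
proof -
  let ?e = "ndes (updown xs)"
  let ?A = "\<lambda>d. {i \<in> {..length xs}. ndes (updown (insert_at m i xs)) = d}"
  have r: "ndes (updown (insert_at m i xs)) \<in> {?e, Suc ?e}" if "i \<le> length xs" for i
    using ndes_insert_at[OF assms that] by simp
  then have "?A (Suc ?e) = {..length xs} - ?A ?e" by fastforce
  then have "card (?A (Suc ?e)) = Suc (length xs) - Suc ?e"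
    using card_insert_at_same[OF assms] card_Diff_subset[of "?A ?e" "{..length xs}"] by auto
  moreover have "?A d = {}" if "d \<noteq> ?e" "d \<noteq> Suc ?e" using r that by fastforce
  ultimately show ?thesis using card_insert_at_same[OF assms] by auto
qed

text \<open>The inverse deletes the entry \<open>n\<close> and records the number of entries before
  it.\<close>

lemma bij_betw_insert_at:
  "bij_betw (\<lambda>(xs, i). insert_at n i xs) (permutations_of_set {..<n} \<times> {..n}) (permutations_of_set {..<Suc n})"
proof (rule bij_betw_byWitness[where f' = "\<lambda>ys. (filter (\<lambda>y. y \<noteq> n) ys, length (takeWhile (\<lambda>y. y \<noteq> n) ys))"])
  have F: "filter (\<lambda>y. y \<noteq> n) xs = xs" "takeWhile (\<lambda>y. y \<noteq> n) (take i xs) = take i xs"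
    if "n \<notin> set xs" for xs i
    using that by (auto simp: filter_id_conv takeWhile_eq_all_conv dest: in_set_takeD)
  have T: "takeWhile (\<lambda>y. y \<noteq> n) (take i xs @ n # ys) = take i xs"
    if "n \<notin> set xs" for xs ys i
    using that by (subst takeWhile_append2) (auto dest: in_set_takeD)
  have len: "length xs = n" if "xs \<in> permutations_of_set {..<n}" for xs
    using that length_finite_permutations_of_set by fastforce
  show "\<forall>a\<in>permutations_of_set {..<n} \<times> {..n}.
      (filter (\<lambda>y. y \<noteq> n) (case a of (xs, i) \<Rightarrow> insert_at n i xs),
       length (takeWhile (\<lambda>y. y \<noteq> n) (case a of (xs, i) \<Rightarrow> insert_at n i xs))) = a"
  proof (rule ballI)
    fix a assume "a \<in> permutations_of_set {..<n} \<times> {..n}"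
    then obtain xs i where xs: "xs \<in> permutations_of_set {..<n}" and i: "i \<in> {..n}" and a: "a = (xs, i)"
      by blast
    then have n: "n \<notin> set xs" by (auto simp: permutations_of_set_def)
    have "filter (\<lambda>y. y \<noteq> n) (insert_at n i xs) = filter (\<lambda>y. y \<noteq> n) (take i xs @ drop i xs)"
      unfolding insert_at_def filter_append by simp
    then show "(filter (\<lambda>y. y \<noteq> n) (case a of (xs, i) \<Rightarrow> insert_at n i xs),
       length (takeWhile (\<lambda>y. y \<noteq> n) (case a of (xs, i) \<Rightarrow> insert_at n i xs))) = a"
      using F[OF n] T[OF n] len[OF xs] i a by (simp add: insert_at_def)
  qed
  have split: "\<exists>us vs. ys = us @ n # vs \<and> n \<notin> set us \<and> n \<notin> set vs"
    if ys: "ys \<in> permutations_of_set {..<Suc n}" for ys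
  proof -
    have "n \<in> set ys" "distinct ys" using ys by (auto simp: permutations_of_set_def)
    then obtain us vs where "ys = us @ n # vs" by (meson split_list)
    then show ?thesis using \<open>distinct ys\<close> by auto
  qed
  have tw: "takeWhile (\<lambda>y. y \<noteq> n) (us @ n # vs) = us" if "n \<notin> set us" for us vs
    using that by (subst takeWhile_append2) auto
  show "\<forall>a'\<in>permutations_of_set {..<Suc n}. (case (filter (\<lambda>y. y \<noteq> n) a', length (takeWhile (\<lambda>y. y \<noteq> n) a'))
      of (xs, i) \<Rightarrow> insert_at n i xs) = a'"
  proof
    fix ys assume ys: "ys \<in> permutations_of_set {..<Suc n}"
    then obtain us vs where "ys = us @ n # vs" "n \<notin> set us" "n \<notin> set vs" using split by blast
    then show "(case (filter (\<lambda>y. y \<noteq> n) ys, length (takeWhile (\<lambda>y. y \<noteq> n) ys))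
      of (xs, i) \<Rightarrow> insert_at n i xs) = ys"
      by (simp add: tw F insert_at_def)
  qed
  show "(\<lambda>(xs, i). insert_at n i xs) ` (permutations_of_set {..<n} \<times> {..n}) \<subseteq> permutations_of_set {..<Suc n}"
  proof clarify
    fix xs i assume xs: "xs \<in> permutations_of_set {..<n}"
    then have x: "set xs = {..<n}" "distinct xs" by (auto simp: permutations_of_set_def)
    have "set (take i xs) \<union> set (drop i xs) = set xs" by (metis append_take_drop_id set_append)
    then have "set (insert_at n i xs) = insert n (set xs)" unfolding insert_at_def by auto
    moreover have "set (take i xs) \<inter> set (drop i xs) = {}"
      using x(2) by (metis append_take_drop_id distinct_append)
    then have "distinct (insert_at n i xs)"
      using x by (auto simp: insert_at_def dest!: in_set_takeD in_set_dropD)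
    ultimately show "insert_at n i xs \<in> permutations_of_set {..<Suc n}"
      using xs by (auto simp: permutations_of_set_def)
  qed
  show "(\<lambda>ys. (filter (\<lambda>y. y \<noteq> n) ys, length (takeWhile (\<lambda>y. y \<noteq> n) ys))) ` permutations_of_set {..<Suc n}
      \<subseteq> permutations_of_set {..<n} \<times> {..n}"
  proof (rule image_subsetI)
    fix ys assume ys: "ys \<in> permutations_of_set {..<Suc n}"
    then have "length ys = Suc n" using length_finite_permutations_of_set by fastforce
    moreover obtain us vs where *: "ys = us @ n # vs" "n \<notin> set us" "n \<notin> set vs" using ys split by blast
    moreover have "set us \<union> set vs = {..<n}"
      using ys * by (auto simp: permutations_of_set_def lessThan_Suc)
    ultimately show "(filter (\<lambda>y. y \<noteq> n) ys, length (takeWhile (\<lambda>y. y \<noteq> n) ys)) \<in> permutations_of_set {..<n} \<times> {..n}"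
      using ys by (auto simp: tw F permutations_of_set_def)
  qed
qed

text \<open>A list with \<open>d\<close> descents arises from one with \<open>d\<close> descents in
  \<open>Suc d\<close> ways and from one with \<open>d - 1\<close> descents in
  \<open>Suc n - d\<close> ways. The case distinction protects the truncated
  \<open>d - 1\<close>.\<close>

lemma eulerian_number_Suc:
  "eulerian_number (Suc n) d = Suc d * eulerian_number n d +
     (if d = 0 then 0 else (Suc n - d) * eulerian_number n (d - 1))"
proof -
  let ?P = "permutations_of_set {..<n}"
  have "bij_betw (\<lambda>(xs, i). insert_at n i xs)
     (SIGMA xs:?P. {i \<in> {..n}. ndes (updown (insert_at n i xs)) = d})
     {ys \<in> permutations_of_set {..<Suc n}. ndes (updown ys) = d}"
    unfolding bij_betw_def
  proof
    let ?D = "SIGMA xs:?P. {i \<in> {..n}. ndes (updown (insert_at n i xs)) = d}"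
    let ?f = "\<lambda>(xs, i). insert_at n i xs"
    have sub: "?D \<subseteq> ?P \<times> {..n}" by blast
    show "inj_on ?f ?D"
      using bij_betw_insert_at[of n] sub by (auto simp: bij_betw_def intro: inj_on_subset)
    have D: "?D = {p \<in> ?P \<times> {..n}. ndes (updown (?f p)) = d}" by auto
    show "?f ` ?D = {ys \<in> permutations_of_set {..<Suc n}. ndes (updown ys) = d}"
      unfolding D bij_betw_imp_surj_on[OF bij_betw_insert_at, symmetric] by blast
  qed
  then have "eulerian_number (Suc n) d =
     card (SIGMA xs:?P. {i \<in> {..n}. ndes (updown (insert_at n i xs)) = d})"
    unfolding eulerian_number_word_count word_count_def by (simp add: bij_betw_same_card)
  also have "\<dots> = (\<Sum>xs\<in>?P. card {i \<in> {..n}. ndes (updown (insert_at n i xs)) = d})"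
    by (rule card_SigmaI) auto
  also have "\<dots> = (\<Sum>xs\<in>?P. Suc d * (if ndes (updown xs) = d then 1 else 0) +
      (if d = 0 then 0 else (Suc n - d) * (if ndes (updown xs) = d - 1 then 1 else 0)))"
  proof (rule sum.cong[OF refl])
    fix xs assume xs: "xs \<in> ?P"
    then have "\<forall>x\<in>set xs. x < n" "length xs = n"
      using length_finite_permutations_of_set[of xs "{..<n}"] by (auto simp: permutations_of_set_def)
    then show "card {i \<in> {..n}. ndes (updown (insert_at n i xs)) = d} =
       Suc d * (if ndes (updown xs) = d then 1 else 0) +
      (if d = 0 then 0 else (Suc n - d) * (if ndes (updown xs) = d - 1 then 1 else 0))"
      using card_insert_at[of xs n d] by auto
  qed
  also have "\<dots> = Suc d * eulerian_number n d +
     (if d = 0 then 0 else (Suc n - d) * eulerian_number n (d - 1))"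
    unfolding sum.distrib sum_distrib_left[symmetric]
    by (simp add: eulerian_number_word_count word_count_def sum_distrib_left[symmetric] Int_def flip: sum.inter_filter)
  finally show ?thesis .
qed

section \<open>Closed formulas for at most three descents\<close>

lemma eulerian_number_0: "eulerian_number 0 d = (if d = 0 then 1 else 0)"
  by (simp add: eulerian_number_word_count word_count_0)

lemma eulerian_number_eq_0: "n \<le> d \<Longrightarrow> 0 < d \<Longrightarrow> eulerian_number n d = 0"
  by (induction n arbitrary: d) (auto simp: eulerian_number_0 eulerian_number_Suc)

lemma eulerian_number_d0: "eulerian_number n 0 = 1"
  by (induction n) (auto simp: eulerian_number_0 eulerian_number_Suc)

text \<open>Real subtraction replaces truncated subtraction. The difference
  \<open>real n - real d\<close> can be negative only for \<open>n < d\<close>, where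
  \<open>eulerian_number n d\<close> vanishes.\<close>

lemma real_eulerian_number_Suc:
  "real (eulerian_number (Suc n) (Suc d)) =
    (real d + 2) * real (eulerian_number n (Suc d)) + (real n - real d) * real (eulerian_number n d)"
proof (cases "d \<le> n")
  case True
  then show ?thesis by (simp add: eulerian_number_Suc of_nat_diff distrib_right)
next
  case False
  then show ?thesis by (simp add: eulerian_number_eq_0)
qed

lemma eulerian_number_1: "real (eulerian_number n 1) = 2 ^ n - real n - 1"
  by (induction n)
    (auto simp: eulerian_number_0 eulerian_number_d0 real_eulerian_number_Suc[of _ 0, simplified] algebra_simps)

lemma eulerian_number_2:
  "real (eulerian_number n 2) = 3 ^ n - (real n + 1) * 2 ^ n + real n * (real n + 1) / 2"
proof (induction n)
  case (Suc n)
  have "real (eulerian_number (Suc n) 2) =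
      3 * real (eulerian_number n 2) + (real n - 1) * real (eulerian_number n 1)"
    using real_eulerian_number_Suc[of n 1] by (simp add: numeral_2_eq_2)
  then show ?case unfolding Suc eulerian_number_1 by (simp add: field_simps)
qed (simp add: eulerian_number_0)

text \<open>As for one and two descents, this is a case of the classical alternating sum with terms
  \<open>(-1) ^ k * (Suc n choose k) * (d + 1 - k) ^ n\<close>, here written out and checked by the
  recurrence.\<close>

lemma eulerian_number_3:
  "real (eulerian_number n 3) = 4 ^ n - (real n + 1) * 3 ^ n + real n * (real n + 1) / 2 * 2 ^ n
    - (real n + 1) * real n * (real n - 1) / 6"
proof (induction n)
  case (Suc n)
  have "real (eulerian_number (Suc n) 3) =
      4 * real (eulerian_number n 3) + (real n - 2) * real (eulerian_number n 2)"
    using real_eulerian_number_Suc[of n 2] by (simp add: numeral_3_eq_3 numeral_2_eq_2)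
  then show ?case unfolding Suc eulerian_number_2 by (simp add: field_simps)
qed (simp add: eulerian_number_0)

section \<open>Permutations whose word has a given prefix\<close>

text \<open>The number \<open>j\<close> counts only the descents after the prefix \<open>w\<close>,
  so extending \<open>w\<close> by a descent lowers \<open>j\<close> by one.\<close>

definition prefix_count :: "bool list \<Rightarrow> nat \<Rightarrow> nat \<Rightarrow> nat" where
  "prefix_count w n j = word_count n (\<lambda>v. \<exists>u. v = w @ u \<and> ndes u = j)"

lemma prefix_count_Nil: "prefix_count [] n j = eulerian_number n j"
  by (simp add: prefix_count_def eulerian_number_word_count)

lemma prefix_count_eq_0: 
  assumes "n \<le> length w" "w \<noteq> []" shows "prefix_count w n j = 0"
proof -
  have "prefix_count w n j = word_count n (\<lambda>_. False)"
    unfolding prefix_count_def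
    by (rule word_count_cong) (use assms in \<open>cases w; auto\<close>)
  then show ?thesis by simp
qed

lemma prefix_count_self:
  assumes "n = Suc (length w)"
  shows "prefix_count w n 0 = word_count n (\<lambda>v. v = w)"
    and "prefix_count w n (Suc j) = 0"
proof -
  show "prefix_count w n 0 = word_count n (\<lambda>v. v = w)"
    unfolding prefix_count_def by (rule word_count_cong) (use assms in auto)
  have "prefix_count w n (Suc j) = word_count n (\<lambda>_. False)"
    unfolding prefix_count_def
    by (rule word_count_cong) (use assms in auto)
  then show "prefix_count w n (Suc j) = 0" by simp
qed

text \<open>Cut the permutation after its first \<open>k\<close> entries: the first block has word
  exactly \<open>w\<close>, the second has \<open>j\<close> descents, and the letter at the cut can
  be either one.\<close>

lemma prefix_count_concat:
  assumes "k = Suc (length w)" "k < n"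
  shows "prefix_count (w @ [False]) n j + prefix_count (w @ [True]) n j =
    (n choose k) * prefix_count w k 0 * eulerian_number (n - k) j"
proof -
  have *: "updown (take k xs) = w \<and> ndes (updown (drop k xs)) = j \<longleftrightarrow>
      (\<exists>b u. updown xs = w @ b # u \<and> ndes u = j)"
    if "xs \<in> permutations_of_set {..<n}" for xs
  proof -
    have l: "length xs = n" using that length_finite_permutations_of_set by fastforce
    have "updown xs = updown (take k xs) @ (hd (drop k xs) < last (take k xs)) # updown (drop k xs)"
      using updown_append[of "take k xs" "drop k xs"] assms l by fastforce
    moreover have "length (updown (take k xs)) = length w" using assms l by simp
    ultimately show ?thesis by auto
  qed
  have "(n choose k) * word_count k (\<lambda>v. v = w) * word_count (n - k) (\<lambda>v. ndes v = j) =
    card {xs \<in> permutations_of_set {..<n}. updown (take k xs) = w \<and> ndes (updown (drop k xs)) = j}"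
    using word_count_take_drop[of k n "\<lambda>v. v = w" "\<lambda>v. ndes v = j"] assms by simp
  also have "\<dots> = word_count n (\<lambda>v. \<exists>b u. v = w @ b # u \<and> ndes u = j)"
    unfolding word_count_def
    using * by (intro arg_cong[where f = card] Collect_cong) blast
  also have "\<dots> = word_count n (\<lambda>v. (\<exists>b u. v = w @ b # u \<and> ndes u = j) \<and> \<not> v ! length w)
     + word_count n (\<lambda>v. (\<exists>b u. v = w @ b # u \<and> ndes u = j) \<and> \<not> \<not> v ! length w)"
    by (rule word_count_split)
  also have "\<dots> = prefix_count (w @ [False]) n j + prefix_count (w @ [True]) n j"
    unfolding prefix_count_def
    by (intro arg_cong2[where f = "(+)"] word_count_cong) (auto simp: nth_append)
  finally show ?thesis
    by (simp add: prefix_count_self(1)[OF assms(1)] eulerian_number_word_count)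
qed

text \<open>The letter after \<open>w\<close> is either an ascent, or a descent that is taken out of
  the count of later descents.\<close>

lemma prefix_count_next:
  assumes "Suc (length w) < n"
  shows "prefix_count w n 0 = prefix_count (w @ [False]) n 0"
    and "prefix_count w n (Suc j) = prefix_count (w @ [False]) n (Suc j) + prefix_count (w @ [True]) n j"
proof -
  have *: "(\<exists>u. v = w @ u \<and> ndes u = i) \<longleftrightarrow> (\<exists>b u. v = w @ b # u \<and> ndes (b # u) = i)"
    if "length v = n - 1" for v i
  proof -
    have "u \<noteq> []" if "v = w @ u" for u using that \<open>length v = n - 1\<close> assms by auto
    then show ?thesis by (auto simp: neq_Nil_conv) blast+
  qed
  show "prefix_count w n 0 = prefix_count (w @ [False]) n 0"
    unfolding prefix_count_def by (rule word_count_cong) (auto simp: *)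
  have "prefix_count w n (Suc j) = word_count n (\<lambda>v. \<exists>b u. v = w @ b # u \<and> ndes (b # u) = Suc j)"
    unfolding prefix_count_def by (rule word_count_cong) (rule *)
  also have "\<dots> = word_count n (\<lambda>v. (\<exists>b u. v = w @ b # u \<and> ndes (b # u) = Suc j) \<and> \<not> v ! length w)
     + word_count n (\<lambda>v. (\<exists>b u. v = w @ b # u \<and> ndes (b # u) = Suc j) \<and> \<not> \<not> v ! length w)"
    by (rule word_count_split)
  also have "\<dots> = prefix_count (w @ [False]) n (Suc j) + prefix_count (w @ [True]) n j"
    unfolding prefix_count_def
    by (intro arg_cong2[where f = "(+)"] word_count_cong) (auto simp: nth_append)
  finally show "prefix_count w n (Suc j) = prefix_count (w @ [False]) n (Suc j) + prefix_count (w @ [True]) n j" .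
qed

text \<open>Eliminating \<open>w @ [False]\<close> between \<open>prefix_count_concat\<close> and
  \<open>prefix_count_next\<close> gives a recursion that involves only prefixes extended by a
  descent. The short cases of \<open>n\<close> are included so that it holds for all positive
  \<open>n\<close>.\<close>

lemma prefix_count_snoc_True_0:
  assumes "n > 0"
  shows "prefix_count (w @ [True]) n 0 + prefix_count w n 0 =
    (n choose Suc (length w)) * prefix_count w (Suc (length w)) 0"
proof -
  consider "n \<le> length w" | "n = Suc (length w)" | "Suc (length w) < n" by linarith
  then show ?thesis
  proof cases
    case 1
    then have "w \<noteq> []" using assms by auto
    then show ?thesis using 1 by (simp add: prefix_count_eq_0)
  next
    case 2
    then show ?thesis by (simp add: prefix_count_eq_0)
  next
    case 3
    then show ?thesis
      using prefix_count_concat[OF refl 3, of 0] prefix_count_next(1)[OF 3]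
      by (simp add: eulerian_number_d0)
  qed
qed

text \<open>The same elimination when descents remain after the prefix; the last summand comes from
  the descent at the cut.\<close>

lemma prefix_count_snoc_True_Suc:
  assumes "n > 0"
  shows "prefix_count (w @ [True]) n (Suc j) + prefix_count w n (Suc j) =
    (n choose Suc (length w)) * prefix_count w (Suc (length w)) 0
      * eulerian_number (n - Suc (length w)) (Suc j)
    + prefix_count (w @ [True]) n j"
proof -
  consider "n \<le> length w" | "n = Suc (length w)" | "Suc (length w) < n" by linarith
  then show ?thesis
  proof cases
    case 1
    then have "w \<noteq> []" using assms by auto
    then show ?thesis using 1 by (simp add: prefix_count_eq_0)
  next
    case 2
    then show ?thesis by (simp add: prefix_count_eq_0 prefix_count_self eulerian_number_0)
  next
    case 3
    then show ?thesis
      using prefix_count_concat[OF refl 3, of "Suc j"] prefix_count_next(2)[OF 3] by simp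
  qed
qed

section \<open>Ballot permutations with three descents\<close>

text \<open>The argument \<open>h\<close> is the excess of ascents over descents accumulated so far.\<close>

fun ballot_word :: "nat \<Rightarrow> bool list \<Rightarrow> bool" where
  "ballot_word h [] \<longleftrightarrow> True"
| "ballot_word h (False # w) \<longleftrightarrow> ballot_word (Suc h) w"
| "ballot_word h (True # w) \<longleftrightarrow> h > 0 \<and> ballot_word (h - 1) w"

text \<open>Reading one letter shifts the prefixes by one and changes the initial excess
  \<open>h\<close>, which is why the statement is proved for every \<open>h\<close>.\<close>

lemma ballot_word_iff:
  "ballot_word h w \<longleftrightarrow> (\<forall>k\<le>length w. count_list (take k w) True \<le> h + count_list (take k w) False)"
proof (induction h w rule: ballot_word.induct)
  case (2 h w)
  show ?case unfolding ballot_word.simps 2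
  proof (intro iffI allI impI)
    fix k assume *: "\<forall>k\<le>length w. count_list (take k w) True \<le> Suc h + count_list (take k w) False"
      "k \<le> length (False # w)"
    then show "count_list (take k (False # w)) True \<le> h + count_list (take k (False # w)) False"
      by (cases k) auto
  next
    fix k assume *: "\<forall>k\<le>length (False # w). count_list (take k (False # w)) True \<le> h + count_list (take k (False # w)) False"
      "k \<le> length w"
    then show "count_list (take k w) True \<le> Suc h + count_list (take k w) False"
      using spec[OF *(1), of "Suc k"] by auto
  qed
next
  case (3 h w)
  show ?case
  proof (cases "h > 0")
    case True
    show ?thesis unfolding ballot_word.simps 3 using True
    proof (intro iffI allI impI conjI; (elim conjE)?)
      fix k assume *: "\<forall>k\<le>length w. count_list (take k w) True \<le> h - 1 + count_list (take k w) False"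
        "k \<le> length (True # w)"
      then show "count_list (take k (True # w)) True \<le> h + count_list (take k (True # w)) False"
        using spec[OF *(1), of "k - 1"] True by (cases k) auto
    next
      fix k assume *: "\<forall>k\<le>length (True # w). count_list (take k (True # w)) True \<le> h + count_list (take k (True # w)) False"
        "k \<le> length w"
      then show "count_list (take k w) True \<le> h - 1 + count_list (take k w) False"
        using spec[OF *(1), of "Suc k"] True by auto
    qed auto
  next
    case False
    then show ?thesis by (auto intro!: exI[of _ 1])
  qed
qed auto

lemma ballot_iff_ballot_word:
  assumes "\<pi> permutes {1..n}"
  shows "ballot n \<pi> \<longleftrightarrow> ballot_word 0 (updown (one_line n \<pi>))"
proof -
  have len: "length (updown (one_line n \<pi>)) = n - 1" by (simp add: one_line_def)
  have "k \<in> {1..<n} \<longleftrightarrow> 0 < k \<and> k \<le> n - 1" for k by auto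
  \<comment> \<open>The empty prefix satisfies the inequality trivially, so \<open>k = 0\<close> may
    be added to the range.\<close>
  moreover have "P 0 \<Longrightarrow> (\<forall>k. 0 < k \<and> k \<le> m \<longrightarrow> P k) \<longleftrightarrow> (\<forall>k\<le>m. P k)" for P and m :: nat
    by (metis neq0_conv)
  ultimately show ?thesis
    unfolding ballot_def ballot_word_iff card_descents_upto card_ascents_upto[OF assms] len Ball_def
    by simp
qed

lemma ballot_number_word_count:
  "ballot_number n d = word_count n (\<lambda>w. ballot_word 0 w \<and> ndes w = d)"
proof -
  have "{\<pi>. \<pi> permutes {1..n} \<and> ballot n \<pi> \<and> card (descents n \<pi>) = d} =
    {\<pi>. \<pi> permutes {1..n} \<and> ballot_word 0 (updown (one_line n \<pi>)) \<and> ndes (updown (one_line n \<pi>)) = d}"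
    using ballot_iff_ballot_word card_descents by auto
  then show ?thesis unfolding ballot_number_def
    using card_permutes_updown[of n "\<lambda>w. ballot_word 0 w \<and> ndes w = d"] by simp
qed

lemma ballot_word_if_ndes_le: "ndes w \<le> h \<Longrightarrow> ballot_word h w"
  by (induction h w rule: ballot_word.induct) auto

text \<open>Keeping \<open>d\<close> next to \<open>h\<close> makes the recursion finite: a descent
  lowers both, an ascent raises \<open>h\<close> alone, and by \<open>nonballot_few\<close> nothing
  is left once \<open>d \<le> h\<close>.\<close>

definition nonballot :: "nat \<Rightarrow> nat \<Rightarrow> bool list \<Rightarrow> bool" where
  "nonballot h d w \<longleftrightarrow> \<not> ballot_word h w \<and> ndes w = d"

lemma nonballot_few: "d \<le> h \<Longrightarrow> \<not> nonballot h d w"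
  by (auto simp: nonballot_def ballot_word_if_ndes_le)

lemma nonballot_0_Suc:
  "nonballot 0 (Suc d) w \<longleftrightarrow>
    (\<exists>u. w = True # u \<and> ndes u = d) \<or> (\<exists>u. w = False # u \<and> nonballot 1 (Suc d) u)"
  by (cases "(0::nat, w)" rule: ballot_word.cases) (auto simp: nonballot_def)

lemma nonballot_Suc_Suc:
  "nonballot (Suc h) (Suc d) w \<longleftrightarrow>
    (\<exists>u. w = True # u \<and> nonballot h d u) \<or> (\<exists>u. w = False # u \<and> nonballot (Suc (Suc h)) (Suc d) u)"
  by (cases "(Suc h, w)" rule: ballot_word.cases) (auto simp: nonballot_def)

text \<open>Each prefix ends at the first position where descents outnumber ascents. A prefix of
  length \<open>2 * i + 1\<close> contains \<open>i + 1\<close> of the three descents and leaves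
  \<open>2 - i\<close> for the rest.\<close>

lemma nonballot_0_3_iff:
  "nonballot 0 3 w \<longleftrightarrow>
     (\<exists>u. w = [True] @ u \<and> ndes u = 2) \<or>
     (\<exists>u. w = [False, True, True] @ u \<and> ndes u = 1) \<or>
     (\<exists>u. w = [False, False, True, True, True] @ u \<and> ndes u = 0) \<or>
     (\<exists>u. w = [False, True, False, True, True] @ u \<and> ndes u = 0)"
proof -
  have "nonballot 0 1 v \<longleftrightarrow> (\<exists>u. v = True # u \<and> ndes u = 0)" for v
    using nonballot_0_Suc[of 0 v] by (auto simp: nonballot_few)
  moreover have "nonballot 1 2 v \<longleftrightarrow> (\<exists>u. v = True # u \<and> nonballot 0 1 u)" for v
    using nonballot_Suc_Suc[of 0 1 v] by (auto simp: nonballot_few numeral_2_eq_2)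
  moreover have "nonballot 2 3 v \<longleftrightarrow> (\<exists>u. v = True # u \<and> nonballot 1 2 u)" for v
    using nonballot_Suc_Suc[of 1 2 v] by (auto simp: nonballot_few numeral_2_eq_2 numeral_3_eq_3)
  moreover have "nonballot 0 2 v \<longleftrightarrow> (\<exists>u. v = True # u \<and> ndes u = 1) \<or> (\<exists>u. v = False # u \<and> nonballot 1 2 u)" for v
    using nonballot_0_Suc[of 1 v] by (auto simp: numeral_2_eq_2)
  moreover have "nonballot 1 3 v \<longleftrightarrow> (\<exists>u. v = True # u \<and> nonballot 0 2 u) \<or> (\<exists>u. v = False # u \<and> nonballot 2 3 u)" for v
    using nonballot_Suc_Suc[of 0 2 v] by (auto simp: numeral_2_eq_2 numeral_3_eq_3)
  moreover have "nonballot 0 3 v \<longleftrightarrow> (\<exists>u. v = True # u \<and> ndes u = 2) \<or> (\<exists>u. v = False # u \<and> nonballot 1 3 u)" for v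
    using nonballot_0_Suc[of 2 v] by (auto simp: numeral_3_eq_3)
  ultimately show ?thesis by auto
qed

lemma eulerian_number_3_ballot:
  "eulerian_number n 3 = ballot_number n 3 + prefix_count [True] n 2
     + prefix_count [False, True, True] n 1
     + prefix_count [False, False, True, True, True] n 0
     + prefix_count [False, True, False, True, True] n 0"
proof -
  have "eulerian_number n 3 = word_count n (\<lambda>w. ndes w = 3 \<and> ballot_word 0 w)
      + word_count n (\<lambda>w. ndes w = 3 \<and> \<not> ballot_word 0 w)"
    unfolding eulerian_number_word_count by (rule word_count_split)
  also have "word_count n (\<lambda>w. ndes w = 3 \<and> ballot_word 0 w) = ballot_number n 3"
    unfolding ballot_number_word_count by (rule word_count_cong) auto
  also have "word_count n (\<lambda>w. ndes w = 3 \<and> \<not> ballot_word 0 w) = word_count n (nonballot 0 3)"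
    by (rule word_count_cong) (auto simp: nonballot_def)
  also have "\<dots> = prefix_count [True] n 2
     + (prefix_count [False, True, True] n 1
     + (prefix_count [False, False, True, True, True] n 0
     + prefix_count [False, True, False, True, True] n 0))"
    unfolding nonballot_0_3_iff[abs_def] prefix_count_def
    \<comment> \<open>The alternatives exclude each other because none of the four prefixes begins
      another.\<close>
    by (subst word_count_disj, fastforce)+ simp
  finally show ?thesis by simp
qed

section \<open>Binomial coefficients as polynomials\<close>

lemma choose_2_real: "real (n choose 2) = real n * (real n - 1) / 2"
  by (induction n) (simp_all add: numeral_2_eq_2 field_simps)

lemma choose_3_real: "real (n choose 3) = real n * (real n - 1) * (real n - 2) / 6"
proof (induction n)
  case (Suc n)
  have "Suc n choose 3 = (n choose 2) + (n choose 3)" by (simp add: numeral_3_eq_3 numeral_2_eq_2)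
  then show ?case by (simp add: Suc choose_2_real field_simps)
qed simp

lemma choose_4_real:
  "real (n choose 4) = real n * (real n - 1) * (real n - 2) * (real n - 3) / 24"
proof (induction n)
  case (Suc n)
  have "Suc n choose 4 = (n choose 3) + (n choose 4)"
    using binomial_Suc_Suc[of n 3] by simp
  then show ?case by (simp add: Suc choose_3_real field_simps)
qed simp

lemma choose_5_real:
  "real (n choose 5) = real n * (real n - 1) * (real n - 2) * (real n - 3) * (real n - 4) / 120"
proof (induction n)
  case (Suc n)
  have "Suc n choose 5 = (n choose 4) + (n choose 5)"
    using binomial_Suc_Suc[of n 4] by simp
  then show ?case by (simp add: Suc choose_4_real field_simps)
qed simp

text \<open>The two recursions for prefixes ending in a descent give a linear system for the four
  counts in \<open>eulerian_number_3_ballot\<close>; solving it leaves only binomial coefficients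
  and Eulerian numbers with closed forms.\<close>

lemma ballot_number_3:
  assumes "n \<ge> 4"
  shows "real (ballot_number n 3) = 4 * real (eulerian_number (n - 1) 3)
     - (real (n choose 3) - real (n choose 2) + 4) * 2 ^ (n - 2)
      - 22 * real (n choose 5) + 16 * real (n choose 4) - 4 * real (n choose 3) + 2 * real n"
proof -
  let ?F = prefix_count and ?E = eulerian_number
  let ?A = False and ?D = True
  note zero = prefix_count_snoc_True_0 and suc = prefix_count_snoc_True_Suc
  \<comment> \<open>An ascent followed by no descent at all leaves only the increasing
    arrangement.\<close>
  have "1 < m \<Longrightarrow> ?F [?A] m 0 = 1" for m
    using prefix_count_next(1)[of "[]" m] by (simp add: prefix_count_Nil eulerian_number_d0)
  note A0 = this
  have AA0: "2 < m \<Longrightarrow> ?F [?A, ?A] m 0 = 1" for m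
    using prefix_count_next(1)[of "[?A]" m] A0[of m] by simp
  have D0: "0 < m \<Longrightarrow> ?F [?D] m 0 + 1 = m" for m
    using zero[of m "[]"] by (simp add: prefix_count_Nil eulerian_number_d0)
  have D1: "0 < m \<Longrightarrow> ?F [?D] m 1 + ?E m 1 = m * ?E (m - 1) 1 + ?F [?D] m 0" for m
    using suc[of m "[]" 0] by (simp add: prefix_count_Nil eulerian_number_d0)
  have D2: "0 < m \<Longrightarrow> ?F [?D] m 2 + ?E m 2 = m * ?E (m - 1) 2 + ?F [?D] m 1" for m
    using suc[of m "[]" 1] by (simp add: prefix_count_Nil eulerian_number_d0 numeral_2_eq_2)
  have AD0: "1 < m \<Longrightarrow> ?F [?A, ?D] m 0 + 1 = m choose 2" for m
    using zero[of m "[?A]"] A0[of m] A0[of 2] by (simp add: numeral_2_eq_2)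
  have A1: "1 < m \<Longrightarrow> ?E m 1 = ?F [?A] m 1 + ?F [?D] m 0" for m
    using prefix_count_next(2)[of "[]" m 0] by (simp add: prefix_count_Nil)
  have AD1: "1 < m \<Longrightarrow> ?F [?A, ?D] m 1 + ?F [?A] m 1 = (m choose 2) * ?E (m - 2) 1 + ?F [?A, ?D] m 0" for m
    using suc[of m "[?A]" 0] A0[of 2] by (simp add: numeral_2_eq_2)
  \<comment> \<open>The facts named \<open>n_\<close> followed by a word give the number of
    permutations with exactly that word. They are the factors
    \<open>prefix_count w (Suc (length w)) 0\<close> in the recursions for longer prefixes.\<close>
  have n_AD: "?F [?A, ?D] 3 0 = 2" using AD0[of 3] by (simp add: choose_two)
  have ADD0: "3 \<le> m \<Longrightarrow> ?F [?A, ?D, ?D] m 0 + ?F [?A, ?D] m 0 = (m choose 3) * 2" for m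
    using zero[of m "[?A, ?D]"] n_AD by (simp add: numeral_3_eq_3)
  have ADD1: "3 \<le> m \<Longrightarrow> ?F [?A, ?D, ?D] m 1 + ?F [?A, ?D] m 1 =
     (m choose 3) * 2 * ?E (m - 3) 1 + ?F [?A, ?D, ?D] m 0" for m
    using suc[of m "[?A, ?D]" 0] n_AD by (simp add: numeral_3_eq_3)
  have AAD0: "3 \<le> m \<Longrightarrow> ?F [?A, ?A, ?D] m 0 + 1 = m choose 3" for m
    using zero[of m "[?A, ?A]"] AA0[of m] AA0[of 3] by (simp add: numeral_3_eq_3)
  have chooses: "4 choose 3 = (4::nat)" "5 choose 3 = (10::nat)" "5 choose 4 = (5::nat)" "4 choose 2 = (6::nat)" "5 choose 2 = (10::nat)"
    by (simp_all add: numeral_eq_Suc)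
  have n_AAD: "?F [?A, ?A, ?D] 4 0 = 3" using AAD0[of 4] chooses by simp
  have AADD0: "4 \<le> m \<Longrightarrow> ?F [?A, ?A, ?D, ?D] m 0 + ?F [?A, ?A, ?D] m 0 = (m choose 4) * 3" for m
    using zero[of m "[?A, ?A, ?D]"] n_AAD by (simp add: eval_nat_numeral)
  have n_AADD: "?F [?A, ?A, ?D, ?D] 5 0 = 6" using AADD0[of 5] AAD0[of 5] chooses by simp
  have AADDD0: "4 \<le> m \<Longrightarrow> ?F [?A, ?A, ?D, ?D, ?D] m 0 + ?F [?A, ?A, ?D, ?D] m 0 = (m choose 5) * 6" for m
    using zero[of m "[?A, ?A, ?D, ?D]"] n_AADD by (simp add: eval_nat_numeral)
  have ADA0: "4 \<le> m \<Longrightarrow> ?F [?A, ?D, ?A] m 0 = ?F [?A, ?D] m 0" for m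
    using prefix_count_next(1)[of "[?A, ?D]" m] by simp
  have n_ADA: "?F [?A, ?D, ?A] 4 0 = 5" using ADA0[of 4] AD0[of 4] chooses by simp
  have ADAD0: "4 \<le> m \<Longrightarrow> ?F [?A, ?D, ?A, ?D] m 0 + ?F [?A, ?D, ?A] m 0 = (m choose 4) * 5" for m
    using zero[of m "[?A, ?D, ?A]"] n_ADA by (simp add: eval_nat_numeral)
  have n_ADAD: "?F [?A, ?D, ?A, ?D] 5 0 = 16" using ADAD0[of 5] ADA0[of 5] AD0[of 5] chooses by simp
  have ADADD0: "4 \<le> m \<Longrightarrow> ?F [?A, ?D, ?A, ?D, ?D] m 0 + ?F [?A, ?D, ?A, ?D] m 0 = (m choose 5) * 16" for m
    using zero[of m "[?A, ?D, ?A, ?D]"] n_ADAD by (simp add: eval_nat_numeral)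
  note eqs = D0 D1 D2 AD0 A1 AD1 ADD0 ADD1 AAD0 AADD0 AADDD0 ADA0 ADAD0 ADADD0
  have ge: "0 < n" "1 < n" "3 \<le> n" "4 \<le> n" using assms by auto
  note reals = eqs[of n, THEN arg_cong[where f = real], unfolded of_nat_add of_nat_mult of_nat_1 of_nat_numeral]
  have "real (ballot_number n 3) = real (?E n 3) - real (?F [?D] n 2) - real (?F [?A, ?D, ?D] n 1)
     - real (?F [?A, ?A, ?D, ?D, ?D] n 0) - real (?F [?A, ?D, ?A, ?D, ?D] n 0)"
    using eulerian_number_3_ballot[of n] by simp
  \<comment> \<open>From here on the intermediate prefix counts are eliminated linearly, one of the
    four terms at a time.\<close>
  also have "real (?F [?D] n 2) = n * real (?E (n - 1) 2) - ?E n 2 + n * real (?E (n - 1) 1) - ?E n 1 + n - 1"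
    using reals(1-3) ge by linarith
  also have "real (?F [?A, ?D, ?D] n 1) = 2 * real (n choose 3) * ?E (n - 3) 1
      - real (n choose 2) * ?E (n - 2) 1 + ?E n 1 - n - 2 * real (n choose 2) + 2 * real (n choose 3) + 3"
    using reals(1,4-8) ge by linarith
  also have "real (?F [?A, ?A, ?D, ?D, ?D] n 0) = 6 * real (n choose 5) - 3 * real (n choose 4) + real (n choose 3) - 1"
    using reals(9-11) ge by linarith
  also have "real (?F [?A, ?D, ?A, ?D, ?D] n 0) = 16 * real (n choose 5) - 5 * real (n choose 4) + real (n choose 2) - 1"
    using reals(4,12-14) ge by linarith
  finally have b: "real (ballot_number n 3) = real (?E n 3) -
     (n * real (?E (n - 1) 2) - ?E n 2 + n * real (?E (n - 1) 1) - ?E n 1 + n - 1) -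
     (2 * real (n choose 3) * ?E (n - 3) 1
      - real (n choose 2) * ?E (n - 2) 1 + ?E n 1 - n - 2 * real (n choose 2) + 2 * real (n choose 3) + 3) -
     (6 * real (n choose 5) - 3 * real (n choose 4) + real (n choose 3) - 1) -
     (16 * real (n choose 5) - 5 * real (n choose 4) + real (n choose 2) - 1)" .
  \<comment> \<open>Writing \<open>n = m + 4\<close> removes truncated subtractions and turns all
    powers into multiples of \<open>2 ^ m\<close>, \<open>3 ^ m\<close> and
    \<open>4 ^ m\<close>.\<close>
  obtain m where n: "n = m + 4" using assms by (metis add.commute le_Suc_ex)
  have sub: "n - 1 = m + 3" "n - 2 = m + 2" "n - 3 = m + 1" using n by auto
  show ?thesis
    unfolding b unfolding sub eulerian_number_1 eulerian_number_2 eulerian_number_3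
      choose_2_real choose_3_real choose_4_real choose_5_real unfolding n
    by (simp add: power_add field_simps)
qed

section \<open>Removing the cycle of the largest element\<close>

definition join :: "nat list \<Rightarrow> (nat \<Rightarrow> nat) \<Rightarrow> nat \<Rightarrow> nat" where
  "join cs \<sigma> = cycle_of_list cs \<circ> \<sigma>"

lemma cycle_of_list_nth:
  assumes "distinct cs" "i < length cs"
  shows "cycle_of_list cs (cs ! i) = cs ! (Suc i mod length cs)"
proof -
  have "map (cycle_of_list cs) cs = rotate1 cs"
    using cyclic_rotation[OF assms(1), of 1] by simp
  then show ?thesis using assms(2) by (metis nth_map nth_rotate1)
qed

text \<open>A permutation with one cycle split off: \<open>cs\<close> lists that cycle from a chosen
  starting point and \<open>\<sigma>\<close> acts on the remaining elements
  \<open>R\<close>.\<close>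

locale joined =
  fixes cs :: "nat list" and \<sigma> :: "nat \<Rightarrow> nat" and R :: "nat set"
  assumes dist: "distinct cs" and ne: "cs \<noteq> []" and perm: "\<sigma> permutes R"
    and disj: "set cs \<inter> R = {}" and fin: "finite R"
begin

lemma join_in: "y \<in> set cs \<Longrightarrow> join cs \<sigma> y = cycle_of_list cs y"
  using disj permutes_not_in[OF perm, of y] by (auto simp: join_def disjoint_iff)

lemma join_notin: "y \<notin> set cs \<Longrightarrow> join cs \<sigma> y = \<sigma> y"
proof -
  assume y: "y \<notin> set cs"
  have "\<sigma> y \<notin> set cs"
    by (metis y perm disj permutes_not_in permutes_in_image disjoint_iff)
  then show ?thesis by (simp add: join_def id_outside_supp)
qed

lemma join_permutes: "join cs \<sigma> permutes (set cs \<union> R)"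
  unfolding join_def
  by (rule permutes_compose) (auto intro: permutes_subset[OF perm] permutes_subset[OF cycle_permutes])

lemma join_permutation: "permutation (join cs \<sigma>)"
  using join_permutes fin by (auto simp: permutation_permutes intro!: exI[of _ "set cs \<union> R"])

text \<open>Iterating from the head reads off the list cyclically. This identifies the orbit and
  later recovers \<open>cs\<close> from the joined permutation.\<close>

lemma funpow_join: "(join cs \<sigma> ^^ i) (hd cs) = cs ! (i mod length cs)"
proof (induction i)
  case 0
  then show ?case using ne by (simp add: hd_conv_nth)
next
  case (Suc i)
  have "i mod length cs < length cs" using ne by simp
  then show ?case
    using Suc by (simp add: join_in cycle_of_list_nth[OF dist] mod_Suc_eq)
qed

lemma orbit_join_hd: "orbit (join cs \<sigma>) (hd cs) = set cs"
proof -
  have "orbit (join cs \<sigma>) (hd cs) = {cs ! (i mod length cs) | i. True}"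
    unfolding orbit_altdef_permutation[OF join_permutation] funpow_join ..
  also have "\<dots> = set cs"
    using ne by (auto simp: set_conv_nth) (metis mod_less)
  finally show ?thesis .
qed

lemma orbit_join_in:
  assumes "y \<in> set cs" shows "orbit (join cs \<sigma>) y = set cs"
proof -
  have "cyclic_on (join cs \<sigma>) (orbit (join cs \<sigma>) (hd cs))"
    by (rule cyclic_on_orbit'[OF join_permutation])
  then show ?thesis using assms unfolding orbit_join_hd by (auto simp: cyclic_on_alldef)
qed

lemma orbit_join_notin:
  assumes "y \<in> R" shows "orbit (join cs \<sigma>) y = orbit \<sigma> y"
proof (rule orbit_cong0[OF assms])
  have "join cs \<sigma> z = \<sigma> z" if "z \<in> R" for z using that disj join_notin by blast
  then show "join cs \<sigma> \<in> R \<rightarrow> R" "\<And>z. z \<in> R \<Longrightarrow> join cs \<sigma> z = \<sigma> z"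
    using permutes_in_image[OF perm] by auto
qed

lemma orbits_join: "orbit (join cs \<sigma>) ` (set cs \<union> R) = insert (set cs) (orbit \<sigma> ` R)"
proof -
  have "orbit (join cs \<sigma>) ` set cs = {set cs}"
    using ne orbit_join_in by (auto simp: image_iff) (metis last_in_set)
  moreover have "orbit (join cs \<sigma>) ` R = orbit \<sigma> ` R" using orbit_join_notin by auto
  ultimately show ?thesis by (simp add: image_Un)
qed

lemma orbit_subset_R: "C \<in> orbit \<sigma> ` R \<Longrightarrow> C \<subseteq> R"
  using permutes_orbit_subset[OF perm] by auto

lemma set_cs_notin_orbits: "set cs \<notin> orbit \<sigma> ` R"
  using orbit_subset_R disj ne by (metis inf.absorb1 set_empty)

lemma cycle_M_join_notin:
  assumes "C \<in> orbit \<sigma> ` R" shows "cycle_M (join cs \<sigma>) C = cycle_M \<sigma> C"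
proof -
  have "join cs \<sigma> c = \<sigma> c" if "c \<in> C" for c
    using orbit_subset_R[OF assms] that disj join_notin by blast
  then have "{c \<in> C. c \<le> join cs \<sigma> c} = {c \<in> C. c \<le> \<sigma> c}" "{c \<in> C. join cs \<sigma> c < c} = {c \<in> C. \<sigma> c < c}"
    by auto
  then show ?thesis by (simp add: cycle_M_def cyc_asc_def cyc_des_def)
qed

text \<open>The nonempty set \<open>set cs\<close> is disjoint from \<open>R\<close>, so it is a new
  orbit, and on the old orbits \<open>join\<close> agrees with \<open>\<sigma>\<close>.\<close>

lemma sum_cycle_M_join:
  "(\<Sum>C\<in>orbit (join cs \<sigma>) ` (set cs \<union> R). cycle_M (join cs \<sigma>) C) =
    cycle_M (join cs \<sigma>) (set cs) + (\<Sum>C\<in>orbit \<sigma> ` R. cycle_M \<sigma> C)"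
  unfolding orbits_join using set_cs_notin_orbits fin
  by (simp add: cycle_M_join_notin)

text \<open>Since the head is the largest entry, the closing step from the last entry back to the
  head is never a descent. The cyclic descents are therefore those of the list.\<close>

lemma cyc_des_join:
  assumes "\<forall>x\<in>set cs. x \<le> hd cs"
  shows "cyc_des (join cs \<sigma>) (set cs) = ndes (updown cs)"
proof -
  have "{c \<in> set cs. join cs \<sigma> c < c} = (\<lambda>i. cs ! i) ` {i. i < length (updown cs) \<and> updown cs ! i = True}"
  proof (intro equalityI subsetI)
    fix c assume c: "c \<in> {c \<in> set cs. join cs \<sigma> c < c}"
    then obtain i where i: "i < length cs" "c = cs ! i" by (auto simp: in_set_conv_nth)
    have lt: "cs ! (Suc i mod length cs) < cs ! i"
      using c i by (simp add: join_in cycle_of_list_nth[OF dist])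
    have "Suc i < length cs"
    proof (rule ccontr)
      assume "\<not> Suc i < length cs"
      then have "Suc i = length cs" using i by simp
      then have "hd cs < cs ! i" using lt ne by (simp add: hd_conv_nth)
      then show False using assms i by (meson leD nth_mem)
    qed
    then show "c \<in> (\<lambda>i. cs ! i) ` {i. i < length (updown cs) \<and> updown cs ! i = True}"
      using lt i by (intro image_eqI[of _ _ i]) (auto simp: nth_updown)
  next
    fix c assume "c \<in> (\<lambda>i. cs ! i) ` {i. i < length (updown cs) \<and> updown cs ! i = True}"
    then obtain i where i: "i < length cs - 1" "updown cs ! i" "c = cs ! i" by auto
    then have "Suc i < length cs" by simp
    then show "c \<in> {c \<in> set cs. join cs \<sigma> c < c}"
      using i by (simp add: join_in cycle_of_list_nth[OF dist] nth_updown)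
  qed
  moreover have "inj_on (\<lambda>i. cs ! i) {i. i < length (updown cs) \<and> updown cs ! i = True}"
    using dist by (auto intro!: inj_on_nth)
  ultimately show ?thesis
    by (simp add: cyc_des_def card_image count_list_conv_card)
qed

lemma cycle_M_join_in:
  assumes "\<forall>x\<in>set cs. x \<le> hd cs"
  shows "cycle_M (join cs \<sigma>) (set cs) = min (length cs - ndes (updown cs)) (ndes (updown cs))"
proof -
  have "{c \<in> set cs. c \<le> join cs \<sigma> c} = set cs - {c \<in> set cs. join cs \<sigma> c < c}" by auto
  then have "cyc_asc (join cs \<sigma>) (set cs) = length cs - cyc_des (join cs \<sigma>) (set cs)"
    by (simp add: cyc_asc_def cyc_des_def card_Diff_subset distinct_card[OF dist])
  then show ?thesis by (simp add: cycle_M_def cyc_des_join[OF assms])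
qed

end

text \<open>Iterating from the common head yields the same list; outside it \<open>join\<close> is
  \<open>\<sigma>\<close>, and on it both \<open>\<sigma>\<close> and \<open>\<sigma>'\<close> are
  the identity.\<close>

lemma join_inject:
  assumes "joined cs \<sigma> R" "joined cs' \<sigma>' R'" "hd cs = hd cs'" "join cs \<sigma> = join cs' \<sigma>'"
  shows "cs = cs' \<and> \<sigma> = \<sigma>'"
proof -
  interpret J: joined cs \<sigma> R by fact
  interpret J': joined cs' \<sigma>' R' by fact
  have s: "set cs = set cs'" using J.orbit_join_hd J'.orbit_join_hd assms(3,4) by simp
  then have l: "length cs = length cs'" using J.dist J'.dist by (metis distinct_card)
  have "cs ! i = cs' ! i" if "i < length cs" for i
    using J.funpow_join[of i] J'.funpow_join[of i] assms(3,4) that l by simp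
  then have cs: "cs = cs'" using l by (simp add: nth_equalityI)
  have "\<sigma> x = \<sigma>' x" for x
  proof (cases "x \<in> set cs")
    case True
    then have "x \<notin> R" "x \<notin> R'" using J.disj J'.disj s by auto
    then show ?thesis using J.perm J'.perm by (simp add: permutes_not_in)
  next
    case False
    then show ?thesis using J.join_notin J'.join_notin assms(4) s by metis
  qed
  then show ?thesis using cs by blast
qed

text \<open>The library's \<open>support\<close> lists the orbit of \<open>m\<close> starting with
  \<open>m\<close>; restricting \<open>\<pi>\<close> to the complement of that orbit gives
  \<open>\<sigma>\<close>.\<close>

lemma ex_join:
  assumes "\<pi> permutes S" "finite S" "m \<in> S"
  shows "\<exists>xs \<sigma>. set (m # xs) \<subseteq> S \<and> joined (m # xs) \<sigma> (S - set (m # xs)) \<and> \<pi> = join (m # xs) \<sigma>"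
proof -
  have p: "permutation \<pi>" using assms permutation_permutes by blast
  define cs where "cs = support \<pi> m"
  have lp: "least_power \<pi> m > 0" by (rule least_power_of_permutation(2)[OF p])
  then have ne: "cs \<noteq> []" and hd: "hd cs = m"
    unfolding cs_def by (simp, simp add: hd_map)
  then obtain xs where xs: "cs = m # xs" by (metis list.collapse)
  have orb: "set cs = orbit \<pi> m"
    unfolding cs_def support_set[OF p] orbit_altdef_permutation[OF p] by auto
  have dist: "distinct cs" unfolding cs_def by (rule cycle_of_permutation[OF p])
  have sub: "set cs \<subseteq> S" unfolding orb by (rule permutes_orbit_subset[OF assms(1,3)])
  define \<sigma> where "\<sigma> = perm_restrict \<pi> (S - set cs)"
  have "\<sigma> permutes (S - set cs)"
    unfolding \<sigma>_def orb by (rule perm_restrict_diff_cyclic[OF assms(1) cyclic_on_orbit'[OF p]])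
  then interpret J: joined cs \<sigma> "S - set cs"
    by unfold_locales (use dist ne assms in auto)
  have "\<pi> x = join cs \<sigma> x" for x
  proof (cases "x \<in> set cs")
    case True
    then show ?thesis using J.join_in[OF True] cycle_restrict[OF p, of x m] by (simp add: cs_def)
  next
    case False
    then show ?thesis using J.join_notin[OF False] permutes_not_in[OF assms(1), of x]
      by (auto simp: \<sigma>_def perm_restrict_def)
  qed
  then have "\<pi> = join cs \<sigma>" by blast
  then show ?thesis using xs J.joined_axioms sub by metis
qed

text \<open>Stated for an arbitrary set \<open>S\<close>, because removing a cycle from
  \<open>{1..n}\<close> leaves an arbitrary subset.\<close>

definition odd_cycle_perms :: "nat set \<Rightarrow> nat \<Rightarrow> (nat \<Rightarrow> nat) set" where
  "odd_cycle_perms S d = {\<pi>. \<pi> permutes S \<and> (\<forall>C\<in>orbit \<pi> ` S. odd (card C)) \<and>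
     (\<Sum>C\<in>orbit \<pi> ` S. cycle_M \<pi> C) = d}"

lemma odd_cycle_number_conv: "odd_cycle_number n d = card (odd_cycle_perms {1..n} d)"
  by (simp add: odd_cycle_number_def odd_cycle_perms_def perm_M_def cycles_of_def)

lemma finite_odd_cycle_perms: "finite S \<Longrightarrow> finite (odd_cycle_perms S d)"
  unfolding odd_cycle_perms_def by (rule finite_subset[OF _ finite_permutations[of S]]) auto

text \<open>This is \<open>M\<close> of the cycle \<open>m # xs\<close> with \<open>m\<close>
  maximal, \<open>j = length xs\<close> and \<open>w\<close> the word of \<open>xs\<close>. For
  \<open>j > 0\<close> the step from \<open>m\<close> adds one descent to those of
  \<open>xs\<close>, which leaves \<open>j - ndes w\<close> cyclic ascents among
  \<open>j + 1\<close> steps. A fixed point has \<open>M = 0\<close>.\<close>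

definition word_M :: "nat \<Rightarrow> bool list \<Rightarrow> nat" where
  "word_M j w = (if j = 0 then 0 else min (j - ndes w) (Suc (ndes w)))"

lemma cycle_M_join_Cons:
  assumes "joined (m # xs) \<sigma> R" "\<forall>x\<in>set xs. x < m"
  shows "cycle_M (join (m # xs) \<sigma>) (set (m # xs)) = word_M (length xs) (updown xs)"
proof -
  interpret joined "m # xs" \<sigma> R by fact
  have "\<forall>x\<in>set (m # xs). x \<le> hd (m # xs)" using assms(2) by auto
  from cycle_M_join_in[OF this] show ?thesis
    using assms(2) by (cases xs) (auto simp: word_M_def)
qed

text \<open>The set \<open>T\<close> holds the companions of \<open>m\<close> in its cycle, an even
  number since the cycle is odd, and \<open>xs\<close> is their order when the cycle is read from
  \<open>m\<close>. The condition \<open>word_M ... \<le> d\<close> keeps the subtraction of its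
  contribution from \<open>d\<close> exact.\<close>

lemma bij_betw_join:
  assumes "finite S" "\<forall>x\<in>S. x < m"
  shows "bij_betw (\<lambda>(T, xs, \<sigma>). join (m # xs) \<sigma>)
    (SIGMA T:{T. T \<subseteq> S \<and> even (card T)}. SIGMA xs:permutations_of_set T.
      {\<sigma>. word_M (card T) (updown xs) \<le> d \<and> \<sigma> \<in> odd_cycle_perms (S - T) (d - word_M (card T) (updown xs))})
    (odd_cycle_perms (insert m S) d)" (is "bij_betw ?f ?D ?Q")
proof -
  have J: "joined (m # xs) \<sigma> (S - T)"
    if "T \<subseteq> S" "xs \<in> permutations_of_set T" "\<sigma> permutes (S - T)" for T xs \<sigma>
    using that assms by unfold_locales (auto simp: permutations_of_set_def)
  have eq: "join (m # xs) \<sigma> \<in> ?Q \<longleftrightarrow> even (card T) \<and> word_M (card T) (updown xs) \<le> d \<and>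
      \<sigma> \<in> odd_cycle_perms (S - T) (d - word_M (card T) (updown xs))"
    if *: "T \<subseteq> S" "xs \<in> permutations_of_set T" "\<sigma> permutes (S - T)" for T xs \<sigma>
  proof -
    interpret joined "m # xs" \<sigma> "S - T" using J[OF *] .
    have xs: "set xs = T" "distinct xs" using *(2) by (auto simp: permutations_of_set_def)
    then have len: "length xs = card T" using distinct_card by metis
    have un: "set (m # xs) \<union> (S - T) = insert m S" using *(1) xs by auto
    have c: "card (set (m # xs)) = Suc (card T)" using distinct_card[OF dist] len by simp
    have M: "cycle_M (join (m # xs) \<sigma>) (set (m # xs)) = word_M (card T) (updown xs)"
      using cycle_M_join_Cons[OF J[OF *]] assms(2) *(1) xs len by auto
    have "(\<forall>C\<in>orbit (join (m # xs) \<sigma>) ` insert m S. odd (card C)) \<longleftrightarrow>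
        even (card T) \<and> (\<forall>C\<in>orbit \<sigma> ` (S - T). odd (card C))"
      unfolding un[symmetric] orbits_join using c by auto
    moreover have "(\<Sum>C\<in>orbit (join (m # xs) \<sigma>) ` insert m S. cycle_M (join (m # xs) \<sigma>) C) =
        word_M (card T) (updown xs) + (\<Sum>C\<in>orbit \<sigma> ` (S - T). cycle_M \<sigma> C)"
      unfolding M[symmetric] un[symmetric] by (rule sum_cycle_M_join)
    ultimately show ?thesis
      using join_permutes *(3) unfolding un odd_cycle_perms_def by auto
  qed
  have inj: "inj_on ?f ?D"
  proof (rule inj_onI)
    fix a b assume a: "a \<in> ?D" and b: "b \<in> ?D" and ab: "?f a = ?f b"
    obtain T xs \<sigma> where a': "a = (T, xs, \<sigma>)" "T \<subseteq> S" "xs \<in> permutations_of_set T" "\<sigma> permutes (S - T)"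
      using a by (auto simp: odd_cycle_perms_def)
    obtain T' xs' \<sigma>' where b': "b = (T', xs', \<sigma>')" "T' \<subseteq> S" "xs' \<in> permutations_of_set T'" "\<sigma>' permutes (S - T')"
      using b by (auto simp: odd_cycle_perms_def)
    have "m # xs = m # xs' \<and> \<sigma> = \<sigma>'"
      using ab a'(1) b'(1) by (intro join_inject[OF J[OF a'(2-4)] J[OF b'(2-4)]]) auto
    then show "a = b" using a' b' by (auto simp: permutations_of_set_def)
  qed
  have "?f ` ?D = ?Q"
  proof (intro equalityI subsetI)
    fix \<pi> assume "\<pi> \<in> ?f ` ?D"
    then obtain T xs \<sigma> where *: "\<pi> = join (m # xs) \<sigma>" "T \<subseteq> S" "even (card T)" "xs \<in> permutations_of_set T"
      "word_M (card T) (updown xs) \<le> d" "\<sigma> \<in> odd_cycle_perms (S - T) (d - word_M (card T) (updown xs))"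
      by auto
    moreover from this have "\<sigma> permutes (S - T)" by (simp add: odd_cycle_perms_def)
    ultimately show "\<pi> \<in> ?Q" using eq by blast
  next
    fix \<pi> assume \<pi>: "\<pi> \<in> ?Q"
    then have "\<pi> permutes insert m S" by (simp add: odd_cycle_perms_def)
    then obtain xs \<sigma> where *: "set (m # xs) \<subseteq> insert m S"
      "joined (m # xs) \<sigma> (insert m S - set (m # xs))" "\<pi> = join (m # xs) \<sigma>"
      using ex_join[of \<pi> "insert m S" m] assms(1) by auto
    interpret joined "m # xs" \<sigma> "insert m S - set (m # xs)" by fact
    define T where "T = set xs"
    have T: "T \<subseteq> S" "xs \<in> permutations_of_set T" using *(1) dist by (auto simp: T_def)
    have "insert m S - set (m # xs) = S - T" using assms(2) by (auto simp: T_def)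
    then have "\<sigma> permutes (S - T)" using perm by simp
    from eq[OF T this] \<pi> * have "even (card T) \<and> word_M (card T) (updown xs) \<le> d \<and>
      \<sigma> \<in> odd_cycle_perms (S - T) (d - word_M (card T) (updown xs))" by simp
    then show "\<pi> \<in> ?f ` ?D" using T *(3) by (intro image_eqI[of _ _ "(T, xs, \<sigma>)"]) auto
  qed
  then show ?thesis using inj by (simp add: bij_betw_def)
qed

text \<open>The number of ways to order \<open>j\<close> given smaller elements after a maximum so
  that the resulting cycle has odd length and \<open>M = k\<close>.\<close>

definition cycle_count :: "nat \<Rightarrow> nat \<Rightarrow> nat" where
  "cycle_count j k = (if even j then word_count j (\<lambda>w. word_M j w = k) else 0)"

text \<open>Counting both sides of \<open>bij_betw_join\<close>, grouped by the size
  \<open>j\<close> of \<open>T\<close> and the value \<open>k\<close> of \<open>word_M\<close>. The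
  function \<open>q\<close> stands for the counts on smaller sets, which the induction below knows
  to depend on cardinality only.\<close>

lemma card_odd_cycle_perms_insert:
  assumes "finite S" "\<forall>x\<in>S. x < m"
    and IH: "\<And>R e. R \<subseteq> S \<Longrightarrow> card (odd_cycle_perms R e) = q (card R) e"
  shows "card (odd_cycle_perms (insert m S) d) =
    (\<Sum>j\<le>card S. (card S choose j) * (\<Sum>k\<le>d. cycle_count j k * q (card S - j) (d - k)))"
proof -
  let ?h = "\<lambda>j. \<Sum>k\<le>d. cycle_count j k * q (card S - j) (d - k)"
  let ?Sig = "\<lambda>T. SIGMA xs:permutations_of_set T.
      {\<sigma>. word_M (card T) (updown xs) \<le> d \<and> \<sigma> \<in> odd_cycle_perms (S - T) (d - word_M (card T) (updown xs))}"
  have finSig: "finite (?Sig T)" for T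
    by (rule finite_SigmaI) (use assms(1) in \<open>auto simp: finite_odd_cycle_perms\<close>)
  have cardSig: "card (?Sig T) = ?h (card T)" if T: "T \<subseteq> S" "even (card T)" for T
  proof -
    have finT: "finite T" using T assms(1) finite_subset by blast
    have cST: "card (S - T) = card S - card T" using T finT by (simp add: card_Diff_subset)
    have "card (?Sig T) = (\<Sum>xs\<in>permutations_of_set T.
        card {\<sigma>. word_M (card T) (updown xs) \<le> d \<and> \<sigma> \<in> odd_cycle_perms (S - T) (d - word_M (card T) (updown xs))})"
      by (rule card_SigmaI) (use assms(1) in \<open>auto simp: finite_odd_cycle_perms\<close>)
    also have "\<dots> = (\<Sum>xs\<in>permutations_of_set T. \<Sum>k\<le>d.
        (if word_M (card T) (updown xs) = k then q (card S - card T) (d - k) else 0))"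
    proof (rule sum.cong[OF refl])
      fix xs
      show "card {\<sigma>. word_M (card T) (updown xs) \<le> d \<and> \<sigma> \<in> odd_cycle_perms (S - T) (d - word_M (card T) (updown xs))}
         = (\<Sum>k\<le>d. (if word_M (card T) (updown xs) = k then q (card S - card T) (d - k) else 0))"
        using IH[of "S - T"] by (auto simp: cST)
    qed
    also have "\<dots> = (\<Sum>k\<le>d. \<Sum>xs\<in>permutations_of_set T.
        (if word_M (card T) (updown xs) = k then q (card S - card T) (d - k) else 0))"
      by (rule sum.swap)
    also have "\<dots> = ?h (card T)"
    proof (rule sum.cong[OF refl])
      fix k
      have "(\<Sum>xs\<in>permutations_of_set T. (if word_M (card T) (updown xs) = k then q (card S - card T) (d - k) else 0))
        = card {xs \<in> permutations_of_set T. word_M (card T) (updown xs) = k} * q (card S - card T) (d - k)"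
        by (simp add: Int_def flip: sum.inter_filter)
      also have "card {xs \<in> permutations_of_set T. word_M (card T) (updown xs) = k} = cycle_count (card T) k"
        using card_updown[OF finT, of "\<lambda>w. word_M (card T) w = k"] T by (simp add: cycle_count_def)
      finally show "(\<Sum>xs\<in>permutations_of_set T. (if word_M (card T) (updown xs) = k then q (card S - card T) (d - k) else 0))
        = cycle_count (card T) k * q (card S - card T) (d - k)" .
    qed
    finally show ?thesis .
  qed
  have "card (odd_cycle_perms (insert m S) d) = card (SIGMA T:{T. T \<subseteq> S \<and> even (card T)}. ?Sig T)"
    using bij_betw_same_card[OF bij_betw_join[OF assms(1,2)]] by simp
  also have "\<dots> = (\<Sum>T | T \<subseteq> S \<and> even (card T). card (?Sig T))"
    by (rule card_SigmaI) (use assms(1) finSig in auto)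
  also have "\<dots> = (\<Sum>T | T \<subseteq> S \<and> even (card T). ?h (card T))"
    by (rule sum.cong) (use cardSig in auto)
  \<comment> \<open>Sets of odd size may be included because \<open>cycle_count\<close> vanishes
    there.\<close>
  also have "\<dots> = (\<Sum>T\<in>Pow S. ?h (card T))"
    by (rule sum.mono_neutral_left) (use assms(1) in \<open>auto simp: cycle_count_def\<close>)
  also have "\<dots> = (\<Sum>j\<le>card S. \<Sum>T\<in>{T\<in>Pow S. card T = j}. ?h (card T))"
    by (rule sum.group[symmetric]) (use assms(1) in \<open>auto intro: card_mono\<close>)
  also have "\<dots> = (\<Sum>j\<le>card S. (card S choose j) * ?h j)"
    using n_subsets[OF assms(1)] by (intro sum.cong refl) simp
  finally show ?thesis .
qed

text \<open>Removing the cycle of the maximum gives a recurrence whose right-hand side depends on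
  the set only through its size. It is applied both to \<open>S\<close> and to
  \<open>{1..card S}\<close>.\<close>

lemma card_odd_cycle_perms:
  "finite S \<Longrightarrow> card (odd_cycle_perms S d) = odd_cycle_number (card S) d"
proof (induction "card S" arbitrary: S d rule: less_induct)
  case less
  show ?case
  proof (cases "S = {}")
    case True
    then show ?thesis by (simp add: odd_cycle_number_conv)
  next
    case False
    have *: "card (odd_cycle_perms U d) =
      (\<Sum>j\<le>card S - 1. (card S - 1 choose j) * (\<Sum>k\<le>d. cycle_count j k * odd_cycle_number (card S - 1 - j) (d - k)))"
      if U: "finite U" "card U = card S" for U
    proof -
      define V where "V = U - {Max U}"
      have Une: "U \<noteq> {}" using U False less.prems by auto
      have UV: "U = insert (Max U) V" "finite V" using U(1) Max_in[OF U(1) Une] by (auto simp: V_def)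
      have cV: "card V = card S - 1" using U Une by (simp add: V_def)
      have lt: "\<forall>x\<in>V. x < Max U" using U(1) by (auto simp: V_def le_neq_trans)
      have cS: "card S > 0" using False less.prems by (simp add: card_gt_0_iff)
      have "card (odd_cycle_perms (insert (Max U) V) d) =
        (\<Sum>j\<le>card V. (card V choose j) * (\<Sum>k\<le>d. cycle_count j k * odd_cycle_number (card V - j) (d - k)))"
      proof (rule card_odd_cycle_perms_insert[OF UV(2) lt])
        fix R e assume R: "R \<subseteq> V"
        then have "finite R" "card R \<le> card V" using UV(2) by (auto intro: finite_subset card_mono)
        then show "card (odd_cycle_perms R e) = odd_cycle_number (card R) e"
          using less.hyps[of R e] cV cS by simp
      qed
      then show ?thesis using UV(1) cV by simp
    qed
    show ?thesis unfolding odd_cycle_number_conv using *[OF less.prems refl] *[of "{1..card S}"] by simp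
  qed
qed

lemma odd_cycle_number_Suc:
  "odd_cycle_number (Suc n) d =
    (\<Sum>j\<le>n. (n choose j) * (\<Sum>k\<le>d. cycle_count j k * odd_cycle_number (n - j) (d - k)))"
proof -
  have "insert (Suc n) {1..n} = {1..Suc n}" by auto
  then have "odd_cycle_number (Suc n) d = card (odd_cycle_perms (insert (Suc n) {1..n}) d)"
    by (simp add: odd_cycle_number_conv)
  also have "\<dots> = (\<Sum>j\<le>card {1..n}. (card {1..n} choose j) *
      (\<Sum>k\<le>d. cycle_count j k * odd_cycle_number (card {1..n} - j) (d - k)))"
    by (rule card_odd_cycle_perms_insert) (auto intro: card_odd_cycle_perms finite_subset)
  finally show ?thesis by simp
qed

lemma odd_cycle_number_0: "odd_cycle_number 0 d = (if d = 0 then 1 else 0)"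
proof -
  have "odd_cycle_perms {} d = (if d = 0 then {id} else {})"
    by (auto simp: odd_cycle_perms_def)
  then show ?thesis by (simp add: odd_cycle_number_conv)
qed

section \<open>Cycle counts in terms of Eulerian numbers\<close>

lemma ndes_lt_length: 
  assumes "length w = j - 1" "0 < j" shows "ndes w < j"
  using count_le_length[of w True] assms by linarith

lemma cycle_count_0: "cycle_count j 0 = (if j = 0 then 1 else 0)"
proof (cases "j = 0")
  case False
  have "word_count j (\<lambda>w. word_M j w = 0) = word_count j (\<lambda>_. False)"
    by (rule word_count_cong) (use False ndes_lt_length in \<open>fastforce simp: word_M_def\<close>)
  then show ?thesis using False by (simp add: cycle_count_def)
qed (simp add: cycle_count_def word_M_def word_count_0)

text \<open>The minimum equals \<open>Suc k\<close> exactly for \<open>k\<close> or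
  \<open>j - 1 - k\<close> descents. These differ because \<open>j - 1\<close> is odd, and by
  symmetry they contribute equally.\<close>

lemma cycle_count_Suc:
  "cycle_count j (Suc k) = (if even j \<and> 2 * Suc k \<le> j then 2 * eulerian_number j k else 0)"
proof (cases "even j \<and> 2 * Suc k \<le> j")
  case True
  then obtain i where i: "j = 2 * i" by auto
  have "word_count j (\<lambda>w. word_M j w = Suc k) = word_count j (\<lambda>w. ndes w = k \<or> ndes w = j - 1 - k)"
  proof (rule word_count_cong)
    fix w :: "bool list" assume "length w = j - 1"
    then have "ndes w < j" using ndes_lt_length True by auto
    then show "word_M j w = Suc k \<longleftrightarrow> ndes w = k \<or> ndes w = j - 1 - k"
      using True i unfolding word_M_def by (auto simp: min_def)
  qed
  also have "\<dots> = word_count j (\<lambda>w. (ndes w = k \<or> ndes w = j - 1 - k) \<and> ndes w = k)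
     + word_count j (\<lambda>w. (ndes w = k \<or> ndes w = j - 1 - k) \<and> \<not> ndes w = k)"
    by (rule word_count_split)
  also have "\<dots> = word_count j (\<lambda>w. ndes w = k) + word_count j (\<lambda>w. ndes w = j - 1 - k)"
    by (intro arg_cong2[where f = "(+)"] word_count_cong) (use True i in auto)
  also have "\<dots> = 2 * eulerian_number j k"
    using eulerian_number_symmetric[of k j] True by (simp flip: eulerian_number_word_count)
  finally show ?thesis using True by (simp add: cycle_count_def)
next
  case False
  have "word_count j (\<lambda>w. word_M j w = Suc k) = word_count j (\<lambda>_. False)" if "even j"
  proof (rule word_count_cong)
    fix w :: "bool list"
    from that obtain i where i: "j = 2 * i" by auto
    then have "i \<le> k" using False by auto
    \<comment> \<open>If \<open>ndes w \<le> j\<close>, the two arguments of \<open>min\<close> add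
      up to \<open>2 * i + 1\<close>, so the minimum is at most \<open>i\<close>; otherwise it is
      zero.\<close>
    then show "word_M j w = Suc k \<longleftrightarrow> False" using i unfolding word_M_def by auto
  qed
  then show ?thesis using False by (auto simp: cycle_count_def)
qed

section \<open>Exponential generating functions\<close>

definition egf :: "(nat \<Rightarrow> real) \<Rightarrow> real fps" where
  "egf f = Abs_fps (\<lambda>n. f n / fact n)"

lemma egf_nth: "egf f $ n = f n / fact n"
  by (simp add: egf_def)

lemma egf_mult: "egf f * egf g = egf (\<lambda>n. \<Sum>j\<le>n. real (n choose j) * f j * g (n - j))"
  by (rule fps_ext)
    (auto simp: egf_nth fps_mult_nth atLeast0AtMost sum_divide_distrib binomial_fact field_simps intro!: sum.cong)

lemma egf_sum: "(\<Sum>k\<in>A. egf (f k)) = egf (\<lambda>n. \<Sum>k\<in>A. f k n)"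
  by (rule fps_ext) (simp add: egf_nth fps_sum_nth sum_divide_distrib)

lemma fps_deriv_egf: "fps_deriv (egf f) = egf (\<lambda>n. f (Suc n))"
  by (rule fps_ext) (simp add: egf_nth nonzero_divide_eq_eq field_simps del: of_nat_Suc)

lemma fps_X_power_mult_exp_nth:
  "(fps_X ^ i * fps_exp c) $ n = fact i * real (n choose i) * c ^ (n - i) / fact n"
proof (cases "n < i")
  case False
  then show ?thesis by (simp add: fps_X_power_mult_nth binomial_fact)
qed (simp add: fps_X_power_mult_nth)

text \<open>The equation determines \<open>A $ Suc n\<close> from \<open>A $ n\<close> and
  \<open>H $ n\<close>.\<close>

lemma fps_linear_ODE_unique:
  fixes A B H :: "real fps"
  assumes "fps_deriv A = A + H" "fps_deriv B = B + H" "A $ 0 = B $ 0"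
  shows "A = B"
proof (rule fps_ext)
  fix n show "A $ n = B $ n"
  proof (induction n)
    case (Suc n)
    have "real (Suc n) * A $ Suc n = real (Suc n) * B $ Suc n"
      using arg_cong[OF assms(1), of "\<lambda>f. f $ n"] arg_cong[OF assms(2), of "\<lambda>f. f $ n"] Suc by simp
    then show ?case by (simp del: of_nat_Suc)
  qed (fact assms(3))
qed

text \<open>The triangular system is solved by stating each solution and verifying equation and
  initial value. The factors 3, 12 and 60 clear denominators, so that the verifications are
  identities with integer coefficients in \<open>X\<close>, \<open>y\<close> and
  \<open>z\<close>.\<close>

lemma odd_cycle_ODE_solution:
  fixes X y z P1 P2 P3 G1 G2 G3 :: "real fps"
  defines "X \<equiv> fps_X" and "y \<equiv> fps_exp 1" and "z \<equiv> fps_exp (-1)"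
  assumes P1: "fps_deriv P1 = P1 + G1 * y" "P1 $ 0 = 0"
    and P2: "fps_deriv P2 = P2 + (G1 * P1 + G2 * y)" "P2 $ 0 = 0"
    and P3: "fps_deriv P3 = P3 + (G1 * P2 + G2 * P1 + G3 * y)" "P3 $ 0 = 0"
    and G1: "G1 = y + z - 2"
    and G2: "G2 = y^2 + z^2 - X * (y - z) - (y + z) - X^2"
    and G3: "12 * G3 = 12 * (y^3 + z^3 - (y^2 + z^2) - 2 * X * (y^2 - z^2)) + 6 * X^2 * (y + z) + 12 * X * (y - z) - 11 * X^4"
  shows "60 * P3 = 60 * y^4 - 240 * (X * y^3) + 270 * (X^2 * y^2) - 20 * (X^3 * y^2) - 60 * y^2
     - 80 * (X^3 * y) - 11 * (X^5 * y) + 40 * (X^4 * y) + 120 * (X * y) - 30 * X^2 + 20 * X^3"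
proof -
  \<comment> \<open>Apart from the derivatives and constant terms of \<open>X\<close> and
    \<open>y\<close>, this is the only property of the exponentials that is needed.\<close>
  have yz: "y * z = 1" unfolding y_def z_def by (simp flip: fps_exp_add_mult)
  have dy [simp]: "fps_deriv y = y" and dX [simp]: "fps_deriv X = 1" and y0 [simp]: "y $ 0 = 1" and X0 [simp]: "X $ 0 = 0"
    by (simp_all add: y_def X_def)
  note simps = fps_deriv_power fps_deriv_mult numeral_fps_const[symmetric]
  have P1: "P1 = y^2 - 2 * (X * y) - 1"
  proof (rule fps_linear_ODE_unique[OF P1(1)])
    show "fps_deriv (y^2 - 2 * (X * y) - 1) = (y^2 - 2 * (X * y) - 1) + G1 * y"
      unfolding G1 using yz by (simp add: simps algebra_simps power2_eq_square)
  qed (simp add: P1(2) fps_power_zeroth)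
  have P2: "3 * P2 = 3 * y^3 - 9 * (X * y^2) + (6 * X^2 - X^3 - 3) * y + 3 * X"
  proof (rule fps_linear_ODE_unique)
    show "fps_deriv (3 * P2) = 3 * P2 + 3 * (G1 * P1 + G2 * y)"
      by (simp add: P2(1) algebra_simps)
    \<comment> \<open>The derivative is expanded first, so that a purely polynomial identity modulo
      \<open>y * z = 1\<close> remains for \<open>algebra\<close>.\<close>
    have d: "fps_deriv (3 * y^3 - 9 * (X * y^2) + (6 * X^2 - X^3 - 3) * y + 3 * X) =
       9 * y^3 - 9 * (y^2 + 2 * (X * y^2)) + (12 * X - 3 * X^2) * y + (6 * X^2 - X^3 - 3) * y + 3"
      by (simp add: simps algebra_simps power2_eq_square power3_eq_cube)
    show "fps_deriv (3 * y^3 - 9 * (X * y^2) + (6 * X^2 - X^3 - 3) * y + 3 * X) =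
       (3 * y^3 - 9 * (X * y^2) + (6 * X^2 - X^3 - 3) * y + 3 * X) + 3 * (G1 * P1 + G2 * y)"
      unfolding d G1 G2 P1 using yz by algebra
  qed (simp add: P2(2) fps_power_zeroth)
  show ?thesis
  proof (rule fps_linear_ODE_unique)
    let ?R = "60 * y^4 - 240 * (X * y^3) + 270 * (X^2 * y^2) - 20 * (X^3 * y^2) - 60 * y^2
     - 80 * (X^3 * y) - 11 * (X^5 * y) + 40 * (X^4 * y) + 120 * (X * y) - 30 * X^2 + 20 * X^3"
    show "fps_deriv (60 * P3) = 60 * P3 + (20 * (G1 * (3 * P2)) + 60 * (G2 * P1) + 5 * (12 * G3) * y)"
      by (simp add: P3(1) algebra_simps)
    have d: "fps_deriv ?R = 240 * y^4 - 240 * (y^3 + 3 * (X * y^3)) + 270 * (2 * X * y^2 + 2 * X^2 * y^2)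
      - 20 * (3 * X^2 * y^2 + 2 * X^3 * y^2) - 120 * y^2 - 80 * (3 * X^2 * y + X^3 * y) - 11 * (5 * X^4 * y + X^5 * y)
      + 40 * (4 * X^3 * y + X^4 * y) + 120 * (y + X * y) - 60 * X + 60 * X^2"
      by (simp add: simps algebra_simps power2_eq_square power3_eq_cube power4_eq_xxxx)
    show "fps_deriv ?R = ?R + (20 * (G1 * (3 * P2)) + 60 * (G2 * P1) + 5 * (12 * G3) * y)"
      unfolding d P2 P1 G3 unfolding G1 G2 using yz by algebra
  qed (simp add: P3(2) fps_power_zeroth)
qed

section \<open>Generating functions of cycles and permutations\<close>

definition perm_egf :: "nat \<Rightarrow> real fps" where
  "perm_egf d = egf (\<lambda>n. real (odd_cycle_number n d))"

definition cycle_egf :: "nat \<Rightarrow> real fps" where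
  "cycle_egf k = egf (\<lambda>n. real (cycle_count n k))"

text \<open>Differentiation shifts the sequence, and the sum over \<open>j\<close> in
  \<open>odd_cycle_number_Suc\<close> is a binomial convolution, hence a product. The sum over
  \<open>k\<close> stays, and its term \<open>k = 0\<close> makes the equation linear in
  \<open>perm_egf d\<close>.\<close>

lemma fps_deriv_perm_egf:
  "fps_deriv (perm_egf d) = (\<Sum>k\<le>d. cycle_egf k * perm_egf (d - k))"
proof -
  have "real (odd_cycle_number (Suc n) d) =
      (\<Sum>k\<le>d. \<Sum>j\<le>n. real (n choose j) * real (cycle_count j k) * real (odd_cycle_number (n - j) (d - k)))" for n
    unfolding odd_cycle_number_Suc
    by (subst sum.swap) (simp add: sum_distrib_left mult.assoc)
  then show ?thesis
    unfolding perm_egf_def cycle_egf_def egf_mult egf_sum fps_deriv_egf by simp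
qed

lemma cycle_egf_0: "cycle_egf 0 = 1"
  by (rule fps_ext) (simp add: cycle_egf_def egf_nth cycle_count_0)

lemma perm_egf_nth_0: "perm_egf d $ 0 = (if d = 0 then 1 else 0)"
  by (simp add: perm_egf_def egf_nth odd_cycle_number_0)

lemma perm_egf_0: "perm_egf 0 = fps_exp 1"
proof -
  have "fps_deriv (perm_egf 0) = fps_const 1 * perm_egf 0"
    using fps_deriv_perm_egf[of 0] by (simp add: cycle_egf_0)
  then show ?thesis unfolding fps_exp_unique_ODE by (simp add: perm_egf_nth_0)
qed

lemma fps_X_mult_exp_nth: "(fps_X * fps_exp c) $ n = real n * c ^ (n - 1) / fact n"
  using fps_X_power_mult_exp_nth[of 1 c n] by simp

lemma fps_X2_mult_exp_nth: "(fps_X\<^sup>2 * fps_exp c) $ n = real n * (real n - 1) * c ^ (n - 2) / fact n"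
  using fps_X_power_mult_exp_nth[of 2 c n] by (simp add: choose_2_real)

text \<open>The nonzero counts are 2 at even \<open>n \<ge> 2\<close>. Adding the two exponentials
  cancels odd coefficients and doubles even ones; subtracting 2 removes the constant term.\<close>

lemma cycle_egf_1: "cycle_egf 1 = fps_exp 1 + fps_exp (-1) - 2"
proof (rule fps_ext)
  fix n
  show "cycle_egf 1 $ n = (fps_exp 1 + fps_exp (-1) - 2) $ n"
    using cycle_count_Suc[of n 0]
    by (cases "n = 0"; cases "even n")
      (auto simp: cycle_egf_def egf_nth eulerian_number_d0 fps_numeral_nth elim!: evenE)
qed

text \<open>
  The polynomial terms in the next two lemmas cancel the coefficients at \<open>n = 2\<close> and \<open>n = 4\<close>,
  where the Eulerian number is nonzero although the cycle is too short.
\<close>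

lemma cycle_egf_2: "cycle_egf 2 = fps_exp 2 + fps_exp (-2) - (fps_X * fps_exp 1 - fps_X * fps_exp (-1))
   - (fps_exp 1 + fps_exp (-1)) - fps_X\<^sup>2" (is "_ = ?R")
proof (rule fps_ext)
  fix n
  have l: "cycle_egf 2 $ n = (if even n \<and> 4 \<le> n then 2 * (2 ^ n - real n - 1) else 0) / fact n"
    using cycle_count_Suc[of n 1]
    by (simp add: cycle_egf_def egf_nth eulerian_number_1[unfolded One_nat_def] numeral_2_eq_2)
  have r: "?R $ n = (2 ^ n + (-2) ^ n - (real n - real n * (-1) ^ (n - 1)) - (1 + (-1) ^ n)
      - (if n = 2 then 2 else 0)) / fact n"
    by (simp add: fps_X_mult_exp_nth fps_X_power_nth diff_divide_distrib add_divide_distrib del: fps_X_mult_nth)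
  consider "odd n" | "n = 0" | "n = 2" | "even n" "4 \<le> n"
  proof -
    have "odd n \<or> n = 0 \<or> n = 2 \<or> even n \<and> 4 \<le> n" by presburger
    then show ?thesis using that by blast
  qed
  then show "cycle_egf 2 $ n = ?R $ n"
    unfolding l r by cases auto
qed

lemma cycle_egf_3: "12 * cycle_egf 3 = 12 * (fps_exp 3 + fps_exp (-3)) - 12 * (fps_exp 2 + fps_exp (-2))
   - 24 * (fps_X * fps_exp 2) + 24 * (fps_X * fps_exp (-2))
   + 6 * (fps_X\<^sup>2 * fps_exp 1) + 6 * (fps_X\<^sup>2 * fps_exp (-1))
   + 12 * (fps_X * fps_exp 1) - 12 * (fps_X * fps_exp (-1)) - 11 * fps_X ^ 4" (is "_ = ?R")
proof (rule fps_ext)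
  fix n
  have l: "(12 * cycle_egf 3) $ n = (if even n \<and> 6 \<le> n
      then 24 * (3 ^ n - (real n + 1) * 2 ^ n + real n * (real n + 1) / 2) else 0) / fact n"
    using cycle_count_Suc[of n 2] eulerian_number_2[of n]
    by (simp add: cycle_egf_def egf_nth numeral_3_eq_3 numeral_2_eq_2 numeral_fps_const)
  \<comment> \<open>The value 264 is \<open>11 * fact 4\<close>, from the term
    \<open>11 * fps_X ^ 4\<close>; it equals \<open>24 * eulerian_number 4 2\<close>.\<close>
  have r: "?R $ n = (12 * (3 ^ n + (-3) ^ n) - 12 * (2 ^ n + (-2) ^ n)
      - 24 * (real n * 2 ^ (n - 1)) + 24 * (real n * (-2) ^ (n - 1))
      + 6 * (real n * (real n - 1)) + 6 * (real n * (real n - 1) * (-1) ^ (n - 2))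
      + 12 * real n - 12 * (real n * (-1) ^ (n - 1)) - (if n = 4 then 264 else 0)) / fact n"
    by (simp add: fps_X_mult_exp_nth fps_X2_mult_exp_nth fps_X_power_nth numeral_fps_const
        diff_divide_distrib add_divide_distrib fact_numeral del: fps_X_mult_nth)
  consider "odd n" "n = 1" | "odd n" "n \<ge> 2" | "n = 0" | "n = 2" | "n = 4" | "even n" "6 \<le> n"
  proof -
    have "odd n \<and> n = 1 \<or> odd n \<and> n \<ge> 2 \<or> n = 0 \<or> n = 2 \<or> n = 4 \<or> even n \<and> 6 \<le> n" by presburger
    then show ?thesis using that by blast
  qed
  then show "(12 * cycle_egf 3) $ n = ?R $ n"
    unfolding l r
  proof cases
    case 6
    \<comment> \<open>For even \<open>n\<close> the two terms with base 2 or -2 and exponent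
      \<open>n - 1\<close> combine to \<open>- 24 * n * 2 ^ n\<close>.\<close>
    then have "2 ^ n = 2 * (2::real) ^ (n - 1)" by (cases n) auto
    then show "(if even n \<and> 6 \<le> n
      then 24 * (3 ^ n - (real n + 1) * 2 ^ n + real n * (real n + 1) / 2) else 0) / fact n =
      (12 * (3 ^ n + (-3) ^ n) - 12 * (2 ^ n + (-2) ^ n)
      - 24 * (real n * 2 ^ (n - 1)) + 24 * (real n * (-2) ^ (n - 1))
      + 6 * (real n * (real n - 1)) + 6 * (real n * (real n - 1) * (-1) ^ (n - 2))
      + 12 * real n - 12 * (real n * (-1) ^ (n - 1)) - (if n = 4 then 264 else 0)) / fact n"
      using 6 by (simp add: field_simps)
  qed (auto simp: field_simps)
qed

lemma perm_egf_3:
  "60 * perm_egf 3 = 60 * fps_exp 4 - 240 * (fps_X * fps_exp 3) + 270 * (fps_X ^ 2 * fps_exp 2)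
     - 20 * (fps_X ^ 3 * fps_exp 2) - 60 * fps_exp 2
     - 80 * (fps_X ^ 3 * fps_exp 1) - 11 * (fps_X ^ 5 * fps_exp 1) + 40 * (fps_X ^ 4 * fps_exp 1)
     + 120 * (fps_X * fps_exp 1) - 30 * fps_X ^ 2 + 20 * fps_X ^ 3"
proof -
  have y: "fps_exp 2 = (fps_exp 1 :: real fps) ^ 2" "fps_exp 3 = (fps_exp 1 :: real fps) ^ 3" "fps_exp 4 = (fps_exp 1 :: real fps) ^ 4"
    "fps_exp (-2) = (fps_exp (-1) :: real fps) ^ 2" "fps_exp (-3) = (fps_exp (-1) :: real fps) ^ 3"
    by (simp_all add: fps_exp_power_mult)
  show ?thesis unfolding y
  proof (rule odd_cycle_ODE_solution)
    show "fps_deriv (perm_egf 1) = perm_egf 1 + cycle_egf 1 * fps_exp 1"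
      using fps_deriv_perm_egf[of 1] by (simp add: cycle_egf_0 perm_egf_0)
    show "fps_deriv (perm_egf 2) = perm_egf 2 + (cycle_egf 1 * perm_egf 1 + cycle_egf 2 * fps_exp 1)"
      using fps_deriv_perm_egf[of 2] by (simp add: cycle_egf_0 perm_egf_0 numeral_2_eq_2 add.assoc)
    show "fps_deriv (perm_egf 3) = perm_egf 3 +
       (cycle_egf 1 * perm_egf 2 + cycle_egf 2 * perm_egf 1 + cycle_egf 3 * fps_exp 1)"
      using fps_deriv_perm_egf[of 3] by (simp add: cycle_egf_0 perm_egf_0 numeral_3_eq_3 numeral_2_eq_2 add.assoc)
    show "cycle_egf 1 = fps_exp 1 + fps_exp (-1) - 2" by (rule cycle_egf_1)
    show "cycle_egf 2 = (fps_exp 1)\<^sup>2 + (fps_exp (-1))\<^sup>2 - fps_X * (fps_exp 1 - fps_exp (-1))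
        - (fps_exp 1 + fps_exp (-1)) - fps_X\<^sup>2"
      unfolding cycle_egf_2 y by (simp add: algebra_simps)
    show "12 * cycle_egf 3 = 12 * (fps_exp 1 ^ 3 + fps_exp (-1) ^ 3 - ((fps_exp 1)\<^sup>2 + (fps_exp (-1))\<^sup>2)
        - 2 * fps_X * ((fps_exp 1)\<^sup>2 - (fps_exp (-1))\<^sup>2)) + 6 * fps_X\<^sup>2 * (fps_exp 1 + fps_exp (-1))
        + 12 * fps_X * (fps_exp 1 - fps_exp (-1)) - 11 * fps_X ^ 4"
      unfolding cycle_egf_3 y by (simp add: algebra_simps)
  qed (simp_all add: perm_egf_nth_0)
qed

text \<open>Coefficients of \<open>perm_egf_3\<close>, where \<open>fps_X ^ i * fps_exp c\<close>
  contributes \<open>fact i * (n choose i) * c ^ (n - i)\<close> after multiplication by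
  \<open>fact n\<close>. For \<open>n \<ge> 4\<close> the pure terms in \<open>fps_X ^ 2\<close> and
  \<open>fps_X ^ 3\<close> drop out.\<close>

lemma odd_cycle_number_3:
  assumes "n \<ge> 4"
  shows "60 * real (odd_cycle_number n 3) = 60 * 4 ^ n - 240 * (real n * 3 ^ (n - 1))
     + 540 * real (n choose 2) * 2 ^ (n - 2) - 120 * real (n choose 3) * 2 ^ (n - 3) - 60 * 2 ^ n
     - 480 * real (n choose 3) - 1320 * real (n choose 5) + 960 * real (n choose 4) + 120 * real n"
proof -
  have "60 * real (odd_cycle_number n 3) / fact n = (60 * perm_egf 3) $ n"
    by (simp add: perm_egf_def egf_nth numeral_fps_const)
  also have "\<dots> = (60 * 4 ^ n - 240 * (real n * 3 ^ (n - 1))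
     + 540 * real (n choose 2) * 2 ^ (n - 2) - 120 * real (n choose 3) * 2 ^ (n - 3) - 60 * 2 ^ n
     - 480 * real (n choose 3) - 1320 * real (n choose 5) + 960 * real (n choose 4) + 120 * real n) / fact n"
    unfolding perm_egf_3 using assms
    by (simp add: fps_X_mult_exp_nth fps_X_power_mult_exp_nth fps_X_power_nth numeral_fps_const
        diff_divide_distrib add_divide_distrib fact_numeral mult.assoc del: fps_X_mult_nth)
  finally show ?thesis by simp
qed

lemma odd_cycle_number_eq_ballot_number:
  assumes "n \<ge> 4"
  shows "odd_cycle_number n 3 = ballot_number n 3"
proof -
  obtain m where n: "n = m + 4" using assms by (metis add.commute le_Suc_ex)
  have sub: "n - 1 = m + 3" "n - 2 = m + 2" "n - 3 = m + 1" using n by auto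
  \<comment> \<open>Both sides have closed forms, which are compared as combinations of
    \<open>2 ^ m\<close>, \<open>3 ^ m\<close>, \<open>4 ^ m\<close> and 1 with polynomial
    coefficients.\<close>
  have "60 * real (odd_cycle_number n 3) = 60 * real (ballot_number n 3)"
    unfolding odd_cycle_number_3[OF assms] ballot_number_3[OF assms]
    unfolding sub eulerian_number_3 choose_2_real choose_3_real choose_4_real choose_5_real
    unfolding n by (simp add: power_add field_simps)
  then show ?thesis by simp
qed

theorem theorem1p5:
  fixes n :: nat
  assumes "n \<ge> 4"
  shows "odd_cycle_number n 3 = ballot_number n 3 \<and>
    int (ballot_number n 3) =
      4 * int (eulerian_number (n - 1) 3)
      - (int (n choose 3) - int (n choose 2) + 4) * 2 ^ (n - 2)
      - 22 * int (n choose 5) + 16 * int (n choose 4) - 4 * int (n choose 3) + 2 * int n"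
proof
  show "odd_cycle_number n 3 = ballot_number n 3"
    by (rule odd_cycle_number_eq_ballot_number[OF assms])
  have "real_of_int (int (ballot_number n 3)) = real_of_int
     (4 * int (eulerian_number (n - 1) 3)
      - (int (n choose 3) - int (n choose 2) + 4) * 2 ^ (n - 2)
      - 22 * int (n choose 5) + 16 * int (n choose 4) - 4 * int (n choose 3) + 2 * int n)"
    using ballot_number_3[OF assms] by simp
  then show "int (ballot_number n 3) = 4 * int (eulerian_number (n - 1) 3)
      - (int (n choose 3) - int (n choose 2) + 4) * 2 ^ (n - 2)
      - 22 * int (n choose 5) + 16 * int (n choose 4) - 4 * int (n choose 3) + 2 * int n" by (simp only: of_int_eq_iff)
qed

end
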